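(* Let $(M,\omega)$ be a symplectic manifold of dimension $2n$, let $H:M\to\mathbb{R}$ be a smooth Hamiltonian and let $S=H^{-1}(1)$ be a compact, regular energy surface for $H$ (i.e. $dH(x)\neq0$ for all $x\in S$). Let $N\hookrightarrow M$ be a properly embedded $(n+k)$-dimensional coisotropic submanifold ($0\le k<n$) transverse to $S$, and let $\sim$ be the leaf relation on $N$. Suppose there is a neighbourhood $U$ of $S$ such that $c(U,N,\omega,\sim)<\infty$. Then there are a $\rho>0$ and a dense subset $\Sigma\subset[1-\rho,1+\rho]$ such that $X_H$ admits a leafwise chord on every energy surface $H^{-1}(\lambda)$ with $\lambda\in\Sigma$.
   Context: A submanifold $N$ is coisotropic if $TN^\omega\subset TN$. It is properly embedded in the sense that $\partial N\subset\partial M$ (or $\partial N=\emptyset$). The distribution $\ker(\omega|_N)$ on $N$ is integrable; its leaves are the isotropic leaves. A coisotropic equivalence relation on $N$ is an equivalence relation for which points in the same isotropic leaf are equivalent; the leaf relation on $N$ is $x\sim y$ iff $x,y$ lie in the same isotropic leaf of $N$. $c(U,N,\omega,\sim)$ means $c(U,N\cap U,\omega|_U,\sim|_{N\cap U})$, where $\sim|_{N\cap U}$ is the restriction to $N\cap U$ of the leaf relation of $N$, and $c$ is defined as follows. For a symplectic manifold $(M,\omega)$ with coisotropic submanifold $N$ and coisotropic equivalence relation $\sim$ on $N$: a smooth function $F:M\to\mathbb{R}$ is simple if (i) there are a compact set $K\subset M\setminus\partial M$ with $\emptyset\ne K\cap N\subsetneq N$ and a constant $m(F)$ such that $F\equiv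 m(F)$ on $M\setminus K$; (ii) there is an open set $O\subset M$ with $\emptyset\neq O\cap N\subsetneq N$ on which $F\equiv 0$; (iii) $0\le F\le m(F)$. The Hamiltonian vector field is defined by $\omega(X_F,\cdot)=-dF$. For a solution $\gamma$ of $\dot\gamma=X_F(\gamma)$ with $\gamma(0)\in N$, the return time is $T_\gamma=\inf\{t>0:\gamma(t)\in N,\ \gamma(0)\sim\gamma(t)\}$ ($\inf\emptyset=+\infty$). A simple $F$ is admissible if every solution of $\dot\gamma=X_F(\gamma)$ with $\gamma(0)\in N$ is constant or has $T_\gamma>1$. Then $c(M,N,\omega,\sim)=\sup\{m(F):F\text{ simple and admissible}\}$. A leafwise chord of $X_H$ on $H^{-1}(\lambda)$ is a non-constant solution $\gamma:[0,T]\to H^{-1}(\lambda)$, $T>0$, of $\dot\gamma=X_H(\gamma)$ such that $\gamma(0),\gamma(T)\in N$ lie in the same isotropic leaf of $N$.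
   Formalization: The formal theorem adds two assumptions, without which the claim fails: N meets S (otherwise transversality is vacuous and N may lie far from S), and S is disjoint from the boundary of M (otherwise orbits on S may end at the boundary without returning to N). *)

theory Defs
  imports "HOL-Analysis.Analysis"
begin

section \<open>Smooth maps between subsets of Euclidean spaces\<close>

primrec Ck_on :: "nat \<Rightarrow> ('e::euclidean_space \<Rightarrow> 'f::euclidean_space) \<Rightarrow> 'e set \<Rightarrow> bool" where
  "Ck_on 0 f T \<longleftrightarrow> continuous_on T f"
| "Ck_on (Suc k) f T \<longleftrightarrow>
     (\<forall>x\<in>T. f differentiable (at x)) \<and>
     (\<forall>v. Ck_on k (\<lambda>x. frechet_derivative f (at x) v) T)"

text \<open>A map on an arbitrary set (such as a relatively open subset of a half space) is smooth if
  near every point it extends to a smooth map on an open set.\<close>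

definition smooth_on :: "'e::euclidean_space set \<Rightarrow> ('e \<Rightarrow> 'f::euclidean_space) \<Rightarrow> bool" where
  "smooth_on S f \<longleftrightarrow>
     (\<forall>x\<in>S. \<exists>T g. open T \<and> x \<in> T \<and> (\<forall>k. Ck_on k g T) \<and> (\<forall>y\<in>S \<inter> T. g y = f y))"

definition half_space :: "'e::euclidean_space set" where
  "half_space = {x. 0 \<le> x \<bullet> (SOME b. b \<in> Basis)}"

section \<open>Smooth manifolds with boundary\<close>

text \<open>A manifold is a topology on the point set \<^term>\<open>topspace\<close> of that topology, together with an
  atlas indexed by the type \<open>'i\<close>: the chart \<open>i\<close> is the map \<open>coord i\<close> on the domain \<open>cdom i\<close>.
  Charts with empty domain are harmless, so any set of charts can be indexed by a full type.
  The dimension is the dimension of the model space \<open>'e\<close>.\<close>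

record ('a, 'i, 'e) mfd =
  mtop :: "'a topology"
  cdom :: "'i \<Rightarrow> 'a set"
  coord :: "'i \<Rightarrow> 'a \<Rightarrow> 'e"

abbreviation points :: "('a, 'i, 'e) mfd \<Rightarrow> 'a set" where
  "points M \<equiv> topspace (mtop M)"

definition cinv :: "('a, 'i, 'e) mfd \<Rightarrow> 'i \<Rightarrow> 'e \<Rightarrow> 'a" where
  "cinv M i = inv_into (cdom M i) (coord M i)"

text \<open>The coordinate expression, from chart \<open>i\<close> of \<open>A\<close> to chart \<open>j\<close> of \<open>B\<close>, of the identity map of
  the underlying points. With \<open>B = A\<close> these are the transition maps of \<open>A\<close>; when the points
  of \<open>A\<close> form a subset of those of \<open>B\<close>, they express the inclusion.\<close>

definition trans_map :: "('a, 'i, 'e) mfd \<Rightarrow> 'i \<Rightarrow> ('a, 'j, 'f) mfd \<Rightarrow> 'j \<Rightarrow> 'e \<Rightarrow> 'f" where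
  "trans_map A i B j = coord B j \<circ> cinv A i"

definition jac ::
  "('a, 'i, 'e::euclidean_space) mfd \<Rightarrow> 'i \<Rightarrow> ('a, 'j, 'f::euclidean_space) mfd \<Rightarrow> 'j \<Rightarrow> 'a \<Rightarrow> 'e \<Rightarrow> 'f" where
  "jac A i B j p =
     frechet_derivative (trans_map A i B j)
       (at (coord A i p) within coord A i ` (cdom A i \<inter> cdom B j))"

definition smooth_trans ::
  "('a, 'i, 'e::euclidean_space) mfd \<Rightarrow> ('a, 'j, 'f::euclidean_space) mfd \<Rightarrow> bool" where
  "smooth_trans A B \<longleftrightarrow>
     (\<forall>i j. smooth_on (coord A i ` (cdom A i \<inter> cdom B j)) (trans_map A i B j))"

definition smooth_manifold :: "('a, 'i, 'e::euclidean_space) mfd \<Rightarrow> bool" where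
  "smooth_manifold M \<longleftrightarrow>
     Hausdorff_space (mtop M) \<and> second_countable (mtop M) \<and>
     (\<Union>i. cdom M i) = points M \<and>
     (\<forall>i. openin (mtop M) (cdom M i) \<and>
          (open (coord M i ` cdom M i) \<or>
           openin (top_of_set half_space) (coord M i ` cdom M i)) \<and>
          homeomorphic_map (subtopology (mtop M) (cdom M i))
            (top_of_set (coord M i ` cdom M i)) (coord M i)) \<and>
     smooth_trans M M"

text \<open>For a chart onto a relatively open subset \<open>V\<close> of the half space, the points of \<open>V\<close> on the
  bounding hyperplane are exactly those outside the interior of \<open>V\<close>; for a chart onto an open
  set there are none.\<close>

definition mboundary :: "('a, 'i, 'e::euclidean_space) mfd \<Rightarrow> 'a set" where
  "mboundary M =
     {p. \<exists>i. p \<in> cdom M i \<and> coord M i p \<notin> interior (coord M i ` cdom M i)}"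

definition restrict_mfd :: "('a, 'i, 'e) mfd \<Rightarrow> 'a set \<Rightarrow> ('a, 'i, 'e) mfd" where
  "restrict_mfd M U = M\<lparr>mtop := subtopology (mtop M) U, cdom := (\<lambda>i. cdom M i \<inter> U)\<rparr>"

definition smooth_fun :: "('a, 'i, 'e::euclidean_space) mfd \<Rightarrow> ('a \<Rightarrow> real) \<Rightarrow> bool" where
  "smooth_fun M F \<longleftrightarrow> (\<forall>i. smooth_on (coord M i ` cdom M i) (F \<circ> cinv M i))"

text \<open>Tangent vectors at \<open>p\<close> are represented, in a chart \<open>i\<close> about \<open>p\<close>, by vectors of the model
  space; representatives in two charts are related by \<^const>\<open>jac\<close>. The following is the
  differential of \<open>F\<close> at \<open>p\<close> in the chart \<open>i\<close>.\<close>

definition differential ::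
  "('a, 'i, 'e::euclidean_space) mfd \<Rightarrow> ('a \<Rightarrow> real) \<Rightarrow> 'i \<Rightarrow> 'a \<Rightarrow> 'e \<Rightarrow> real" where
  "differential M F i p =
     frechet_derivative (F \<circ> cinv M i) (at (coord M i p) within coord M i ` cdom M i)"

section \<open>Symplectic forms\<close>

text \<open>A 2-form is given by its coordinate representations: \<open>\<omega> i p u v\<close> is the value at \<open>p\<close> on the
  tangent vectors represented by \<open>u\<close> and \<open>v\<close> in the chart \<open>i\<close>.\<close>

type_synonym ('a, 'i, 'e) form2 = "'i \<Rightarrow> 'a \<Rightarrow> 'e \<Rightarrow> 'e \<Rightarrow> real"

definition smooth_2form ::
  "('a, 'i, 'e::euclidean_space) mfd \<Rightarrow> ('a, 'i, 'e) form2 \<Rightarrow> bool" where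
  "smooth_2form M \<omega> \<longleftrightarrow>
     (\<forall>i. \<forall>p\<in>cdom M i. bilinear (\<omega> i p) \<and> (\<forall>v. \<omega> i p v v = 0)) \<and>
     (\<forall>i j. \<forall>p\<in>cdom M i \<inter> cdom M j. \<forall>u v.
        \<omega> j p (jac M i M j p u) (jac M i M j p v) = \<omega> i p u v) \<and>
     (\<forall>i u v. smooth_on (coord M i ` cdom M i) (\<lambda>x. \<omega> i (cinv M i x) u v))"

definition coord_deriv_2form ::
  "('a, 'i, 'e::euclidean_space) mfd \<Rightarrow> ('a, 'i, 'e) form2 \<Rightarrow> 'i \<Rightarrow> 'a \<Rightarrow> 'e \<Rightarrow> 'e \<Rightarrow> 'e \<Rightarrow> real" where
  "coord_deriv_2form M \<omega> i p u v w =
     frechet_derivative (\<lambda>x. \<omega> i (cinv M i x) v w)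
       (at (coord M i p) within coord M i ` cdom M i) u"

text \<open>Closedness is the usual formula for the exterior derivative on constant coordinate vector
  fields, whose Lie brackets vanish.\<close>

definition closed_2form ::
  "('a, 'i, 'e::euclidean_space) mfd \<Rightarrow> ('a, 'i, 'e) form2 \<Rightarrow> bool" where
  "closed_2form M \<omega> \<longleftrightarrow>
     (\<forall>i. \<forall>p\<in>cdom M i. \<forall>u v w.
        coord_deriv_2form M \<omega> i p u v w + coord_deriv_2form M \<omega> i p v w u
          + coord_deriv_2form M \<omega> i p w u v = 0)"

definition nondegenerate_2form ::
  "('a, 'i, 'e::euclidean_space) mfd \<Rightarrow> ('a, 'i, 'e) form2 \<Rightarrow> bool" where
  "nondegenerate_2form M \<omega> \<longleftrightarrow>
     (\<forall>i. \<forall>p\<in>cdom M i. \<forall>u. (\<forall>v. \<omega> i p u v = 0) \<longrightarrow> u = 0)"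

definition symplectic_manifold ::
  "('a, 'i, 'e::euclidean_space) mfd \<Rightarrow> ('a, 'i, 'e) form2 \<Rightarrow> bool" where
  "symplectic_manifold M \<omega> \<longleftrightarrow>
     smooth_manifold M \<and> smooth_2form M \<omega> \<and> closed_2form M \<omega> \<and> nondegenerate_2form M \<omega>"

section \<open>Submanifolds\<close>

text \<open>A submanifold is a manifold in its own right, on a subset of the points of the ambient
  manifold. An immersed one may carry a finer topology than the subspace topology.\<close>

definition immersed_submanifold ::
  "('a, 'j, 'f::euclidean_space) mfd \<Rightarrow> ('a, 'i, 'e::euclidean_space) mfd \<Rightarrow> bool" where
  "immersed_submanifold N M \<longleftrightarrow>
     smooth_manifold N \<and> points N \<subseteq> points M \<and>
     continuous_map (mtop N) (mtop M) (\<lambda>p. p) \<and> smooth_trans N M \<and>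
     (\<forall>j i. \<forall>p\<in>cdom N j \<inter> cdom M i. inj (jac N j M i p))"

definition embedded_submanifold ::
  "('a, 'j, 'f::euclidean_space) mfd \<Rightarrow> ('a, 'i, 'e::euclidean_space) mfd \<Rightarrow> bool" where
  "embedded_submanifold N M \<longleftrightarrow>
     immersed_submanifold N M \<and> mtop N = subtopology (mtop M) (points N)"

text \<open>The inclusion below also covers submanifolds without boundary.\<close>

definition properly_embedded ::
  "('a, 'j, 'f::euclidean_space) mfd \<Rightarrow> ('a, 'i, 'e::euclidean_space) mfd \<Rightarrow> bool" where
  "properly_embedded N M \<longleftrightarrow> embedded_submanifold N M \<and> mboundary N \<subseteq> mboundary M"

text \<open>The tangent space of \<open>N\<close> at \<open>p\<close>, as a subspace of the tangent space of \<open>M\<close> represented in the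
  chart \<open>i\<close> of \<open>M\<close>.\<close>

definition tangent_space ::
  "('a, 'i, 'e::euclidean_space) mfd \<Rightarrow> ('a, 'j, 'f::euclidean_space) mfd \<Rightarrow> 'i \<Rightarrow> 'a \<Rightarrow> 'e set" where
  "tangent_space M N i p = (\<Union>j\<in>{j. p \<in> cdom N j}. range (jac N j M i p))"

definition symplectic_complement ::
  "('a, 'i, 'e) form2 \<Rightarrow> 'i \<Rightarrow> 'a \<Rightarrow> 'e set \<Rightarrow> 'e set" where
  "symplectic_complement \<omega> i p V = {u. \<forall>w\<in>V. \<omega> i p u w = 0}"

definition coisotropic ::
  "('a, 'i, 'e::euclidean_space) mfd \<Rightarrow> ('a, 'i, 'e) form2 \<Rightarrow> ('a, 'j, 'f::euclidean_space) mfd \<Rightarrow> bool" where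
  "coisotropic M \<omega> N \<longleftrightarrow>
     (\<forall>i. \<forall>p\<in>points N \<inter> cdom M i.
        symplectic_complement \<omega> i p (tangent_space M N i p) \<subseteq> tangent_space M N i p)"

definition ker_dist ::
  "('a, 'i, 'e::euclidean_space) mfd \<Rightarrow> ('a, 'i, 'e) form2 \<Rightarrow> ('a, 'j, 'f::euclidean_space) mfd
     \<Rightarrow> 'i \<Rightarrow> 'a \<Rightarrow> 'e set" where
  "ker_dist M \<omega> N i p =
     {u \<in> tangent_space M N i p. \<forall>w\<in>tangent_space M N i p. \<omega> i p u w = 0}"

definition connected_integral_manifold ::
  "('a, 'i, 'e::euclidean_space) mfd \<Rightarrow> ('a, 'i, 'e) form2 \<Rightarrow> ('a, 'j, 'f::euclidean_space) mfd
     \<Rightarrow> ('a, 'l, 'g::euclidean_space) mfd \<Rightarrow> bool" where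
  "connected_integral_manifold M \<omega> N L \<longleftrightarrow>
     immersed_submanifold L N \<and> connected_space (mtop L) \<and>
     (\<forall>i. \<forall>p\<in>points L \<inter> cdom M i. tangent_space M L i p = ker_dist M \<omega> N i p)"

text \<open>An isotropic leaf of \<open>N\<close> is a maximal connected integral manifold of the distribution. Its
  model space \<open>'g\<close> has to be named because it does not occur in the type of the point set; choosing
  one chart about each point shows that indexing the charts of a leaf by points is no restriction.\<close>

definition isotropic_leaf ::
  "'g::euclidean_space itself \<Rightarrow> ('a, 'i, 'e::euclidean_space) mfd \<Rightarrow> ('a, 'i, 'e) form2
     \<Rightarrow> ('a, 'j, 'f::euclidean_space) mfd \<Rightarrow> 'a set \<Rightarrow> bool" where
  "isotropic_leaf G M \<omega> N A \<longleftrightarrow>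
     (\<exists>L :: ('a, 'a, 'g) mfd. connected_integral_manifold M \<omega> N L \<and> points L = A) \<and>
     (\<forall>L' :: ('a, 'a, 'g) mfd. connected_integral_manifold M \<omega> N L' \<and> A \<subseteq> points L'
        \<longrightarrow> points L' = A)"

text \<open>The disjunct \<open>x = y\<close> matters only at boundary points of \<open>N\<close> where the leaf degenerates to a
  single point (for example on a closed ball, where an affine leaf touches the sphere).\<close>

definition leaf_rel ::
  "'g::euclidean_space itself \<Rightarrow> ('a, 'i, 'e::euclidean_space) mfd \<Rightarrow> ('a, 'i, 'e) form2
     \<Rightarrow> ('a, 'j, 'f::euclidean_space) mfd \<Rightarrow> 'a \<Rightarrow> 'a \<Rightarrow> bool" where
  "leaf_rel G M \<omega> N x y \<longleftrightarrow>
     x \<in> points N \<and> y \<in> points N \<and>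
     (x = y \<or> (\<exists>A. isotropic_leaf G M \<omega> N A \<and> x \<in> A \<and> y \<in> A))"

definition restrict_rel :: "('a \<Rightarrow> 'a \<Rightarrow> bool) \<Rightarrow> 'a set \<Rightarrow> 'a \<Rightarrow> 'a \<Rightarrow> bool" where
  "restrict_rel R B x y \<longleftrightarrow> x \<in> B \<and> y \<in> B \<and> R x y"

text \<open>Transversality of \<open>N\<close> to the level \<open>H = c\<close>, assumed regular, so that its tangent space at a
  point is the kernel of the differential of \<open>H\<close>.\<close>

definition transverse_to_level ::
  "('a, 'i, 'e::euclidean_space) mfd \<Rightarrow> ('a, 'j, 'f::euclidean_space) mfd \<Rightarrow> ('a \<Rightarrow> real) \<Rightarrow> real \<Rightarrow> bool" where
  "transverse_to_level M N H c \<longleftrightarrow>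
     (\<forall>i. \<forall>p\<in>points N \<inter> cdom M i. H p = c \<longrightarrow>
        {u + w | u w. u \<in> tangent_space M N i p \<and> differential M H i p w = 0} = UNIV)"

section \<open>Hamiltonian dynamics and the capacity\<close>

definition ham_vf ::
  "('a, 'i, 'e::euclidean_space) mfd \<Rightarrow> ('a, 'i, 'e) form2 \<Rightarrow> ('a \<Rightarrow> real) \<Rightarrow> 'i \<Rightarrow> 'a \<Rightarrow> 'e" where
  "ham_vf M \<omega> F i p = (THE X. \<forall>v. \<omega> i p X v = - differential M F i p v)"

definition ham_solution ::
  "('a, 'i, 'e::euclidean_space) mfd \<Rightarrow> ('a, 'i, 'e) form2 \<Rightarrow> ('a \<Rightarrow> real) \<Rightarrow> real set
     \<Rightarrow> (real \<Rightarrow> 'a) \<Rightarrow> bool" where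
  "ham_solution M \<omega> F J \<gamma> \<longleftrightarrow>
     continuous_map (top_of_set J) (mtop M) \<gamma> \<and>
     (\<forall>t\<in>J. \<forall>i. \<gamma> t \<in> cdom M i \<longrightarrow>
        ((\<lambda>s. coord M i (\<gamma> s)) has_vector_derivative ham_vf M \<omega> F i (\<gamma> t)) (at t within J))"

text \<open>\<open>simple_ham M N F m\<close>: \<open>F\<close> is simple and \<open>m(F) = m\<close>. The constant is unique, being the maximum
  of \<open>F\<close>.\<close>

definition simple_ham ::
  "('a, 'i, 'e::euclidean_space) mfd \<Rightarrow> 'a set \<Rightarrow> ('a \<Rightarrow> real) \<Rightarrow> real \<Rightarrow> bool" where
  "simple_ham M N F m \<longleftrightarrow>
     smooth_fun M F \<and>
     (\<exists>K. compactin (mtop M) K \<and> K \<subseteq> points M - mboundary M \<and> K \<inter> N \<noteq> {} \<and> K \<inter> N \<subset> N \<and>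
          (\<forall>x\<in>points M - K. F x = m)) \<and>
     (\<exists>Q. openin (mtop M) Q \<and> Q \<inter> N \<noteq> {} \<and> Q \<inter> N \<subset> N \<and> (\<forall>x\<in>Q. F x = 0)) \<and>
     (\<forall>x\<in>points M. 0 \<le> F x \<and> F x \<le> m)"

definition return_time ::
  "'a set \<Rightarrow> ('a \<Rightarrow> 'a \<Rightarrow> bool) \<Rightarrow> (real \<Rightarrow> 'a) \<Rightarrow> ereal" where
  "return_time N R \<gamma> = Inf (ereal ` {t. 0 < t \<and> \<gamma> t \<in> N \<and> R (\<gamma> 0) (\<gamma> t)})"

text \<open>For simple \<open>F\<close> the Hamiltonian vector field has compact support away from the boundary, so
  all its maximal solutions are defined on the whole real line.\<close>

definition admissible ::
  "('a, 'i, 'e::euclidean_space) mfd \<Rightarrow> ('a, 'i, 'e) form2 \<Rightarrow> 'a set \<Rightarrow> ('a \<Rightarrow> 'a \<Rightarrow> bool)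
     \<Rightarrow> ('a \<Rightarrow> real) \<Rightarrow> bool" where
  "admissible M \<omega> N R F \<longleftrightarrow>
     (\<forall>\<gamma>. ham_solution M \<omega> F UNIV \<gamma> \<and> \<gamma> 0 \<in> N \<longrightarrow>
        (\<forall>t. \<gamma> t = \<gamma> 0) \<or> return_time N R \<gamma> > 1)"

definition coisotropic_capacity ::
  "('a, 'i, 'e::euclidean_space) mfd \<Rightarrow> 'a set \<Rightarrow> ('a, 'i, 'e) form2 \<Rightarrow> ('a \<Rightarrow> 'a \<Rightarrow> bool) \<Rightarrow> ennreal" where
  "coisotropic_capacity M N \<omega> R =
     Sup {ennreal m | F m. simple_ham M N F m \<and> admissible M \<omega> N R F}"

text \<open>The capacity of an open subset \<open>U\<close> relative to a submanifold of the ambient manifold: the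
  relation is restricted from \<open>N\<close>, not recomputed on \<open>N \<inter> U\<close>. No restriction of \<open>\<omega>\<close> is
  needed, since the charts of \<^term>\<open>restrict_mfd M U\<close> keep their indices.\<close>

definition capacity_in ::
  "('a, 'i, 'e::euclidean_space) mfd \<Rightarrow> 'a set \<Rightarrow> 'a set \<Rightarrow> ('a, 'i, 'e) form2 \<Rightarrow> ('a \<Rightarrow> 'a \<Rightarrow> bool) \<Rightarrow> ennreal" where
  "capacity_in M U N \<omega> R =
     coisotropic_capacity (restrict_mfd M U) (N \<inter> U) \<omega> (restrict_rel R (N \<inter> U))"

definition leafwise_chord ::
  "'g::euclidean_space itself \<Rightarrow> ('a, 'i, 'e::euclidean_space) mfd \<Rightarrow> ('a, 'i, 'e) form2
     \<Rightarrow> ('a, 'j, 'f::euclidean_space) mfd \<Rightarrow> ('a \<Rightarrow> real) \<Rightarrow> real \<Rightarrow> real \<Rightarrow> (real \<Rightarrow> 'a) \<Rightarrow> bool" where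
  "leafwise_chord G M \<omega> N H c T \<gamma> \<longleftrightarrow>
     0 < T \<and> ham_solution M \<omega> H {0..T} \<gamma> \<and>
     (\<forall>t\<in>{0..T}. H (\<gamma> t) = c) \<and>
     (\<exists>t\<in>{0..T}. \<gamma> t \<noteq> \<gamma> 0) \<and>
     leaf_rel G M \<omega> N (\<gamma> 0) (\<gamma> T)"

end

theory Submission
  imports Defs
begin

text \<open>For a level \<open>\<mu>\<close> close to 1 take \<open>F = f \<circ> H\<close> near \<open>S\<close>, where \<open>f\<close> vanishes near \<open>\<mu>\<close> and is a constant
  \<open>m\<close> above the capacity outside a small interval about \<open>\<mu>\<close>, and \<open>F = m\<close> elsewhere. Then \<open>F\<close> is simple,
  so it cannot be admissible: some nonconstant solution of \<open>X\<^sub>F\<close> returns to its leaf. Since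
  \<open>X\<^sub>F = f'(H) X\<^sub>H\<close> near \<open>S\<close> and \<open>H\<close> is conserved, this solution stays on one level of \<open>H\<close> near \<open>\<mu>\<close> and is
  a constant-speed reparametrization of a solution of \<open>X\<^sub>H\<close>, which is the chord.\<close>

section \<open>Smooth real functions\<close>

text \<open>Nothing is known about a level of \<open>H\<close> away from \<open>S\<close>. So
  everything takes place in a compact neighbourhood \<open>C\<close> of \<open>S\<close> that
  consists of regular interior points inside \<open>U\<close>, and \<open>\<rho>\<close> is so small
  that the slab of \<open>C\<close> about the level 1 lies in an open set \<open>V\<close> inside
  \<open>C\<close>. Gluing the constant \<open>m\<close> outside this slab is then smooth, and the
  boundary does not interfere with the conservation of \<open>H\<close>. Simplicity also asks that
  the compact set off which \<open>F\<close> equals \<open>m\<close>, and the open set on which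
  \<open>F\<close> vanishes, meet the submanifold without containing it. This is where
  transversality enters: it makes \<open>N\<close> meet every level close to 1. Failure of
  admissibility yields some moving solution, on a level that cannot be prescribed. It is only known
  that the derivative of \<open>f\<close> is nonzero there, which puts the level close to
  \<open>\<mu>\<close>; hence a dense set of levels rather than all of them. No flow has to be
  constructed, and the sign of that derivative only decides the direction of the chord.\<close>

lemma frechet_derivative_eqI: "(f has_derivative D) (at x) \<Longrightarrow> frechet_derivative f (at x) = D"
  by (metis frechet_derivative_at)

text \<open>Openness of \<open>T\<close> makes the functions agree near each point, so their
  derivatives agree as well and the induction passes to them.\<close>

lemma Ck_on_cong:
  assumes "open T" "\<And>x. x \<in> T \<Longrightarrow> f x = g x" "Ck_on k f T"
  shows "Ck_on k g T"
  using assms(2,3)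
proof (induction k arbitrary: f g)
  case 0
  then show ?case by (metis Ck_on.simps(1) continuous_on_cong)
next
  case (Suc k)
  have D: "(g has_derivative frechet_derivative f (at x)) (at x)" if "x \<in> T" for x
  proof (rule has_derivative_transform_within_open[OF _ assms(1) that])
    show "(f has_derivative frechet_derivative f (at x)) (at x)"
      using Suc.prems(2) that by (simp add: frechet_derivative_works)
  qed (rule Suc.prems(1))
  have "Ck_on k (\<lambda>x. frechet_derivative g (at x) v) T" for v
  proof (rule Suc.IH)
    show "frechet_derivative f (at x) v = frechet_derivative g (at x) v" if "x \<in> T" for x
      using frechet_derivative_eqI[OF D[OF that]] by simp
    show "Ck_on k (\<lambda>x. frechet_derivative f (at x) v) T"
      using Suc.prems(2) by simp
  qed
  with D show ?case
    unfolding Ck_on.simps differentiable_def by blast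
qed

lemma Ck_on_subset: "Ck_on k f T \<Longrightarrow> S \<subseteq> T \<Longrightarrow> Ck_on k f S"
  by (induction k arbitrary: f) (auto intro: continuous_on_subset)

lemma Ck_on_SucD: "Ck_on (Suc k) f T \<Longrightarrow> Ck_on k f T"
proof (induction k arbitrary: f)
  case 0
  then show ?case
    by (auto intro!: continuous_at_imp_continuous_on differentiable_imp_continuous_within)
next
  case (Suc k)
  show ?case
    unfolding Ck_on.simps(2)[of k]
    using Suc.prems Suc.IH[of "\<lambda>x. frechet_derivative f (at x) _"] by (subst (asm) Ck_on.simps(2)) blast
qed

lemma Ck_on_const: "Ck_on k (\<lambda>x. c) T"
  by (induction k arbitrary: c) (auto simp: frechet_derivative_const)

lemma Ck_on_ident: "Ck_on k (\<lambda>x. x) T"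
  by (cases k) (auto simp: frechet_derivative_ident intro: Ck_on_const)

text \<open>Allows the derivative to be supplied as an explicit formula \<open>D\<close> in place of
  the choice operator \<open>frechet_derivative\<close>; the closure properties below are inductions
  through this rule.\<close>

lemma Ck_on_SucI:
  assumes "open T" "\<And>x. x \<in> T \<Longrightarrow> (f has_derivative D x) (at x)"
    and "\<And>v. Ck_on k (\<lambda>x. D x v) T"
  shows "Ck_on (Suc k) f T"
proof -
  have "Ck_on k (\<lambda>x. frechet_derivative f (at x) v) T" for v
    by (rule Ck_on_cong[OF assms(1) _ assms(3)]) (simp add: frechet_derivative_eqI[OF assms(2)])
  then show ?thesis
    using assms(2) by (auto simp: differentiable_def)
qed

lemma Ck_on_add:
  assumes "open T" "Ck_on k f T" "Ck_on k g T"
  shows "Ck_on k (\<lambda>x. f x + g x) T"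
  using assms(2,3)
proof (induction k arbitrary: f g)
  case 0
  then show ?case by (simp add: continuous_on_add)
next
  case (Suc k)
  show ?case
  proof (rule Ck_on_SucI[OF assms(1)])
    show "((\<lambda>x. f x + g x) has_derivative
        (\<lambda>v. frechet_derivative f (at x) v + frechet_derivative g (at x) v)) (at x)" if "x \<in> T" for x
      using Suc.prems that
      by (auto intro!: derivative_eq_intros simp: frechet_derivative_works)
  qed (use Suc in auto)
qed

lemma Ck_on_mult:
  fixes f g :: "'e::euclidean_space \<Rightarrow> real"
  assumes "open T" "Ck_on k f T" "Ck_on k g T"
  shows "Ck_on k (\<lambda>x. f x * g x) T"
  using assms(2,3)
proof (induction k arbitrary: f g)
  case 0
  then show ?case by (simp add: continuous_on_mult)
next
  case (Suc k)
  show ?case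
  proof (rule Ck_on_SucI[OF assms(1)])
    show "((\<lambda>x. f x * g x) has_derivative
        (\<lambda>v. f x * frechet_derivative g (at x) v + frechet_derivative f (at x) v * g x)) (at x)"
      if "x \<in> T" for x
      using Suc.prems that
      by (intro has_derivative_mult) (auto simp: frechet_derivative_works)
    \<comment> \<open>The product rule brings back \<open>f\<close> and \<open>g\<close> themselves,
      so their order is lowered from \<open>Suc k\<close> to \<open>k\<close> before the induction
      hypothesis applies.\<close>
    show "Ck_on k (\<lambda>x. f x * frechet_derivative g (at x) v + frechet_derivative f (at x) v * g x) T" for v
      using Suc.prems Suc.prems[THEN Ck_on_SucD]
      by (intro Ck_on_add[OF assms(1)] Suc.IH) simp_all
  qed
qed

lemma Ck_on_diff_real:
  fixes f g :: "'e::euclidean_space \<Rightarrow> real"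
  assumes "open T" "Ck_on k f T" "Ck_on k g T"
  shows "Ck_on k (\<lambda>x. f x - g x) T"
  using Ck_on_add[OF assms(1,2) Ck_on_mult[OF assms(1) Ck_on_const[of k "-1"] assms(3)]]
  by simp

text \<open>In the chain rule the outer factor becomes the derivative of \<open>f\<close>. Assuming
  \<open>f\<close> smooth of every order makes the hypothesis hold again for that
  derivative.\<close>

lemma Ck_on_compose:
  fixes h :: "'e::euclidean_space \<Rightarrow> real" and f :: "real \<Rightarrow> real"
  assumes "open T" "\<And>k. Ck_on k f UNIV" "Ck_on k h T"
  shows "Ck_on k (\<lambda>x. f (h x)) T"
  using assms(2,3)
proof (induction k arbitrary: f)
  case 0
  then have "continuous_on UNIV f" "continuous_on T h"
    by (metis Ck_on.simps(1))+
  then show ?case by (simp add: continuous_on_compose2)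
next
  case (Suc k)
  let ?f' = "\<lambda>y. frechet_derivative f (at y) 1"
  have f: "(f has_real_derivative ?f' y) (at y)" for y
  proof -
    have D: "(f has_derivative frechet_derivative f (at y)) (at y)"
      using Suc.prems(1)[of 1] by (simp add: frechet_derivative_works)
    have "c * ?f' y = frechet_derivative f (at y) c" for c
      using linear_scale[OF has_derivative_linear[OF D], of c 1] by simp
    then show ?thesis
      by (rule has_derivative_imp_has_field_derivative[OF D])
  qed
  show ?case
  proof (rule Ck_on_SucI[OF assms(1)])
    show "((\<lambda>x. f (h x)) has_derivative (\<lambda>v. frechet_derivative h (at x) v * ?f' (h x))) (at x)"
      if "x \<in> T" for x
      using Suc.prems(2) that
      by (intro DERIV_compose_FDERIV[OF f]) (simp add: frechet_derivative_works)
    have "Ck_on k ?f' UNIV" for k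
      using Suc.prems(1)[of "Suc k"] by simp
    then have "Ck_on k (\<lambda>x. ?f' (h x)) T"
      by (rule Suc.IH) (rule Ck_on_SucD[OF Suc.prems(2)])
    then show "Ck_on k (\<lambda>x. frechet_derivative h (at x) v * ?f' (h x)) T" for v
      using Suc.prems(2) by (intro Ck_on_mult[OF assms(1)]) simp_all
  qed
qed

section \<open>Flat functions and a smooth well\<close>

text \<open>For \<open>n = 0\<close> this is the standard function exp(-1/x), extended by zero. The
  powers of 1/x are included because differentiation produces them, so that the linear span of the
  family is closed under differentiation.\<close>

definition flat :: "nat \<Rightarrow> real \<Rightarrow> real" where
  "flat n x = (if x \<le> 0 then 0 else (1 / x) ^ n * exp (- (1 / x)))"

lemma flat_tendsto_0: "(flat n \<longlongrightarrow> 0) (at 0)"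
proof -
  have "((\<lambda>x::real. (1 / x) ^ n / exp (1 / x)) \<longlongrightarrow> 0) (at_right 0)"
    using filterlim_compose[OF tendsto_power_div_exp_0[of n] filterlim_inverse_at_top_right]
    by (simp add: divide_inverse)
  then have "(flat n \<longlongrightarrow> 0) (at_right 0)"
    by (rule Lim_transform_eventually)
      (auto simp: flat_def eventually_at_filter exp_minus field_simps)
  moreover have "(flat n \<longlongrightarrow> 0) (at_left 0)"
    by (rule tendsto_eventually) (auto simp: flat_def eventually_at_filter)
  ultimately show ?thesis
    by (simp add: filterlim_split_at)
qed

text \<open>For positive \<open>x\<close>, differentiate y^n exp(-y) with y = 1/x, whose derivative
  is -y^2. At 0 the difference quotient of \<open>flat n\<close> is \<open>flat (n + 1)\<close>,
  which tends to 0.\<close>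

lemma flat_deriv:
  "(flat n has_real_derivative (flat (n + 2) x - real n * flat (n + 1) x)) (at x)"
proof -
  consider "x < 0" | "x = 0" | "x > 0" by linarith
  then show ?thesis
  proof cases
    case 1
    have "((\<lambda>x. 0) has_real_derivative (flat (n + 2) x - real n * flat (n + 1) x)) (at x)"
      using 1 by (auto simp: flat_def)
    then show ?thesis
      by (rule has_field_derivative_transform_within_open[where S="{..<0}"]) (use 1 in \<open>auto simp: flat_def\<close>)
  next
    case 2
    have "(\<lambda>h. (flat n (0 + h) - flat n 0) / h) = flat (n + 1)"
      by (auto simp: flat_def fun_eq_iff)
    with 2 flat_tendsto_0[of "n + 1"] show ?thesis
      by (simp add: DERIV_def flat_def)
  next
    case 3
    define y where "y = 1 / x"
    have y: "((\<lambda>x. 1 / x) has_real_derivative - (y ^ 2)) (at x)"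
      using 3 by (auto intro!: derivative_eq_intros simp: y_def power2_eq_square field_simps)
    \<comment> \<open>The power rule yields the exponent \<open>n - Suc 0\<close>, which is
      truncated for \<open>n = 0\<close>; there the factor \<open>real n\<close> vanishes.\<close>
    have pow: "real n * (- (y ^ 2) * y ^ (n - Suc 0)) = - real n * y ^ (n + 1)"
      by (cases n) (auto simp: power2_eq_square algebra_simps)
    have "((\<lambda>x. (1 / x) ^ n * exp (- (1 / x))) has_real_derivative
        - real n * y ^ (n + 1) * exp (- y) + exp (- y) * y ^ 2 * y ^ n) (at x)"
      using DERIV_mult[OF DERIV_power[OF y, of n, unfolded y_def[symmetric] pow]
          DERIV_fun_exp[OF DERIV_minus[OF y]]]
      by (simp add: y_def)
    moreover have "- real n * y ^ (n + 1) * exp (- y) + exp (- y) * y ^ 2 * y ^ n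
        = flat (n + 2) x - real n * flat (n + 1) x"
      using 3 by (simp add: flat_def y_def[symmetric] power_add power2_eq_square algebra_simps)
    ultimately have "((\<lambda>x. (1 / x) ^ n * exp (- (1 / x))) has_real_derivative
        (flat (n + 2) x - real n * flat (n + 1) x)) (at x)"
      by simp
    then show ?thesis
      by (rule has_field_derivative_transform_within_open[where S="{0<..}"]) (use 3 in \<open>auto simp: flat_def\<close>)
  qed
qed

lemma Ck_on_flat: "Ck_on k (flat n) UNIV"
proof (induction k arbitrary: n)
  case 0
  show ?case
    using flat_deriv by (auto intro!: continuous_at_imp_continuous_on DERIV_isCont)
next
  case (Suc k)
  show ?case
  proof (rule Ck_on_SucI[OF open_UNIV])
    show "(flat n has_derivative (\<lambda>v. (flat (n + 2) x - real n * flat (n + 1) x) * v)) (at x)" for x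
      using flat_deriv by (simp add: has_field_derivative_def)
    show "Ck_on k (\<lambda>x. (flat (n + 2) x - real n * flat (n + 1) x) * v) UNIV" for v
      by (intro Ck_on_mult Ck_on_diff_real Ck_on_const Suc open_UNIV)
  qed
qed

lemma flat_0_mono:
  assumes "x \<le> y" shows "flat 0 x \<le> flat 0 y"
  using assms by (auto simp: flat_def frac_le)

lemma smooth_well_exists:
  fixes a b m \<mu> :: real
  assumes "0 < a" "a < b" "0 < m"
  obtains f where "\<And>k. Ck_on k f UNIV" "\<And>s. b \<le> \<bar>s - \<mu>\<bar> \<Longrightarrow> f s = m"
    "\<And>s. \<bar>s - \<mu>\<bar> \<le> a \<Longrightarrow> f s = 0" "\<And>s. 0 \<le> f s" "\<And>s. f s \<le> m"
proof -
  define c where "c = flat 0 (b\<^sup>2 - a\<^sup>2)"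
  \<comment> \<open>The inner \<open>flat\<close> vanishes once the distance from \<open>s\<close>
    to \<open>\<mu>\<close> is at least \<open>b\<close>, so the normalised outer one gives
    \<open>m\<close>. It is at least \<open>c\<close>, its value at distance \<open>a\<close>, when
    the distance is at most \<open>a\<close>; the outer argument is then nonpositive and the value
    0. Squares are written as products so that \<open>Ck_on_mult\<close> applies.\<close>
  define f where "f s = m / flat 0 c * flat 0 (c - flat 0 (b * b - (s - \<mu>) * (s - \<mu>)))" for s
  have ab: "a\<^sup>2 < b\<^sup>2"
    using assms by (simp add: power_strict_mono)
  then have c: "0 < c" by (simp add: c_def flat_def)
  then have fc: "0 < flat 0 c" by (simp add: flat_def)
  have nn: "0 \<le> flat 0 x" for x by (simp add: flat_def)
  show thesis
  proof
    show "Ck_on k f UNIV" for k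
    proof -
      have "Ck_on k (\<lambda>s. b * b - (s - \<mu>) * (s - \<mu>)) UNIV"
        by (intro Ck_on_mult Ck_on_diff_real Ck_on_const Ck_on_ident open_UNIV)
      from Ck_on_compose[OF open_UNIV Ck_on_flat this]
      have "Ck_on k (\<lambda>s. c - flat 0 (b * b - (s - \<mu>) * (s - \<mu>))) UNIV"
        by (intro Ck_on_diff_real Ck_on_const open_UNIV)
      from Ck_on_compose[OF open_UNIV Ck_on_flat this] show ?thesis
        unfolding f_def by (intro Ck_on_mult Ck_on_const open_UNIV)
    qed
    show "f s = m" if "b \<le> \<bar>s - \<mu>\<bar>" for s
    proof -
      have "b\<^sup>2 \<le> (s - \<mu>)\<^sup>2"
        using that assms by (simp add: abs_le_square_iff[symmetric])
      then have "flat 0 (b * b - (s - \<mu>) * (s - \<mu>)) = 0"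
        by (simp add: flat_def power2_eq_square)
      then show ?thesis using fc by (simp add: f_def)
    qed
    show "f s = 0" if "\<bar>s - \<mu>\<bar> \<le> a" for s
    proof -
      have "(s - \<mu>)\<^sup>2 \<le> a\<^sup>2"
        using that assms by (simp add: abs_le_square_iff[symmetric])
      then have "c \<le> flat 0 (b * b - (s - \<mu>) * (s - \<mu>))"
        unfolding c_def by (intro flat_0_mono) (simp add: power2_eq_square)
      then show ?thesis by (simp add: f_def flat_def[of 0 "c - _"])
    qed
    show "0 \<le> f s" for s
      using assms nn by (simp add: f_def)
    have "flat 0 (c - flat 0 (b * b - (s - \<mu>) * (s - \<mu>))) \<le> flat 0 c" for s
      by (intro flat_0_mono) (simp add: nn)
    then show "f s \<le> m" for s
      using assms fc mult_left_mono[of _ "flat 0 c" "m / flat 0 c"] by (fastforce simp: f_def)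
  qed
qed

section \<open>Smoothness and derivatives on arbitrary sets\<close>

lemma smooth_on_subset:
  assumes "smooth_on S f" "S' \<subseteq> S" "\<And>x. x \<in> S' \<Longrightarrow> f x = g x"
  shows "smooth_on S' g"
  unfolding smooth_on_def
proof
  fix x assume "x \<in> S'"
  then have "x \<in> S" using assms(2) by blast
  then obtain T h where "open T" "x \<in> T" "\<forall>k. Ck_on k h T" "\<forall>y\<in>S \<inter> T. h y = f y"
    using assms(1) unfolding smooth_on_def by meson
  then show "\<exists>T h. open T \<and> x \<in> T \<and> (\<forall>k. Ck_on k h T) \<and> (\<forall>y\<in>S' \<inter> T. h y = g y)"
    using assms(2,3) by (intro exI[of _ T] exI[of _ h]) auto
qed

lemma smooth_on_imp_differentiable:
  assumes "smooth_on S f" "x \<in> S"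
  shows "f differentiable (at x within S)"
proof -
  obtain T g where T: "open T" "x \<in> T" "\<forall>k. Ck_on k g T" "\<forall>y\<in>S \<inter> T. g y = f y"
    using assms unfolding smooth_on_def by meson
  obtain d where d: "0 < d" "ball x d \<subseteq> T"
    using T(1,2) openE by blast
  have "Ck_on (Suc 0) g T" using T(3) by blast
  then have "g differentiable at x" using T(2) by simp
  then have "g differentiable (at x within S)"
    by (rule differentiable_at_withinI)
  then show ?thesis
    using T(4) d assms(2)
    by (auto intro!: differentiable_transform_within[of g x S d f] simp: subset_iff dist_commute)
qed

lemma smooth_on_imp_continuous_on: "smooth_on S f \<Longrightarrow> continuous_on S f"
  by (meson continuous_on_eq_continuous_within differentiable_imp_continuous_within
      smooth_on_imp_differentiable)

text \<open>On a relatively open subset of a half space the derivative is determined by one-sided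
  difference quotients, also at points of the bounding hyperplane.\<close>

lemma has_derivative_unique_chart_image:
  fixes f :: "'e::euclidean_space \<Rightarrow> 'f::real_normed_vector"
  assumes "open T \<or> openin (top_of_set half_space) T" "x \<in> T"
    and "(f has_derivative D) (at x within T)" "(f has_derivative D') (at x within T)"
  shows "D = D'"
proof (rule frechet_derivative_unique_within[OF assms(3,4)])
  fix i :: 'e and e :: real
  assume i: "i \<in> Basis" and e: "0 < e"
  obtain T' where T': "open T'" "T = T' \<or> T = half_space \<inter> T'"
    using assms(1) by (auto simp: openin_open)
  then obtain r where r: "0 < r" "ball x r \<subseteq> T'"
    using assms(2) openE[of T' x] by auto
  define d where "d = min r e / 2"
  have d: "0 < d" "d < r" "d < e" using r e by (auto simp: d_def)
  have "x + d *\<^sub>R i \<in> T'"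
    using i d r(2) by (auto simp: dist_norm subset_iff)
  moreover have "x + d *\<^sub>R i \<in> half_space" if "x \<in> half_space"
  proof -
    have "0 \<le> i \<bullet> (SOME b. b \<in> Basis)"
      using inner_Basis[OF i SOME_Basis] by simp
    then show ?thesis
      using that d by (simp add: half_space_def inner_add_left)
  qed
  ultimately have "x + d *\<^sub>R i \<in> T" using T'(2) assms(2) by auto
  then show "\<exists>d. 0 < \<bar>d\<bar> \<and> \<bar>d\<bar> < e \<and> x + d *\<^sub>R i \<in> T"
    using d by (intro exI[of _ d]) auto
qed

section \<open>Charts\<close>

context
  fixes M :: "('a, 'i, 'e::euclidean_space) mfd"
  assumes M: "smooth_manifold M"
begin

lemma cdom_openin: "openin (mtop M) (cdom M i)"
  using M by (simp add: smooth_manifold_def)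

lemma cdom_subset: "cdom M i \<subseteq> points M"
  using cdom_openin openin_subset by blast

lemma chart_exists: "p \<in> points M \<Longrightarrow> \<exists>i. p \<in> cdom M i"
  using M by (auto simp: smooth_manifold_def)

lemma coord_homeomorphic:
  "homeomorphic_map (subtopology (mtop M) (cdom M i)) (top_of_set (coord M i ` cdom M i)) (coord M i)"
  using M by (simp add: smooth_manifold_def)

lemma points_Int_cdom [simp]: "points M \<inter> cdom M i = cdom M i"
  using cdom_subset by auto

lemma coord_inj_on: "inj_on (coord M i) (cdom M i)"
  using homeomorphic_imp_injective_map[OF coord_homeomorphic] by simp

lemma cinv_coord: "p \<in> cdom M i \<Longrightarrow> cinv M i (coord M i p) = p"
  by (simp add: cinv_def coord_inj_on)

lemma chart_image:
  "open (coord M i ` cdom M i) \<or> openin (top_of_set half_space) (coord M i ` cdom M i)"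
  using M by (simp add: smooth_manifold_def)

text \<open>In a boundary chart an open set has only a relatively open image. The open set
  \<open>T\<close> of the model space is what derivatives and local extensions can be restricted
  to.\<close>

lemma coord_image_openin:
  assumes "openin (mtop M) Q"
  obtains T where "open T" "coord M i ` (cdom M i \<inter> Q) = coord M i ` cdom M i \<inter> T"
proof -
  have "openin (subtopology (mtop M) (cdom M i)) (cdom M i \<inter> Q)"
    using assms by (rule openin_subtopology_Int2)
  then have "openin (top_of_set (coord M i ` cdom M i)) (coord M i ` (cdom M i \<inter> Q))"
    using homeomorphic_map_openness_eq[OF coord_homeomorphic] by blast
  then show thesis
    using that by (auto simp: openin_open)
qed

lemma continuous_map_coord:
  "continuous_map (subtopology (mtop M) (cdom M i)) euclidean (coord M i)"
  using homeomorphic_imp_continuous_map[OF coord_homeomorphic]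
  by (simp add: continuous_map_in_subtopology)

lemma continuous_map_cinv:
  "continuous_map (top_of_set (coord M i ` cdom M i)) (mtop M) (cinv M i)"
proof -
  obtain g where g: "homeomorphic_maps (subtopology (mtop M) (cdom M i))
      (top_of_set (coord M i ` cdom M i)) (coord M i) g"
    using coord_homeomorphic homeomorphic_map_maps by blast
  then have "continuous_map (top_of_set (coord M i ` cdom M i)) (mtop M) g"
    by (auto simp: homeomorphic_maps_def continuous_map_in_subtopology)
  moreover have "g x = cinv M i x" if x: "x \<in> coord M i ` cdom M i" for x
  proof -
    obtain p where "p \<in> cdom M i" "x = coord M i p" using x by auto
    with g show ?thesis by (auto simp: homeomorphic_maps_def cinv_coord)
  qed
  ultimately show ?thesis
    by (rule continuous_map_eq) auto
qed

lemma openin_coord_preimage: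
  assumes "open T"
  shows "openin (mtop M) {p \<in> cdom M i. coord M i p \<in> T}"
proof -
  have "openin (subtopology (mtop M) (cdom M i)) {p \<in> cdom M i. coord M i p \<in> T}"
    using openin_continuous_map_preimage[OF continuous_map_coord, of T i] assms
    by (simp only: topspace_subtopology points_Int_cdom open_openin)
  then show ?thesis
    using cdom_openin openin_trans_full by blast
qed

text \<open>\<open>mboundary\<close> is existential over charts, so a point outside it is interior
  in every chart around it; cutting down by an open \<open>T\<close> preserves this.\<close>

lemma coord_interior:
  assumes "openin (mtop M) Q" "p \<in> cdom M i" "p \<in> Q" "p \<notin> mboundary M"
  shows "coord M i p \<in> interior (coord M i ` (cdom M i \<inter> Q))"
proof -
  obtain T where T: "open T" "coord M i ` (cdom M i \<inter> Q) = coord M i ` cdom M i \<inter> T"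
    using coord_image_openin[OF assms(1)] by metis
  have "coord M i p \<in> interior (coord M i ` cdom M i)"
    using assms(2,4) by (auto simp: mboundary_def)
  moreover have "coord M i p \<in> T"
    using assms T(2) by auto
  ultimately show ?thesis
    unfolding T(2) by (simp add: interior_Int interior_open[OF T(1)])
qed

text \<open>By invariance of domain, being an interior point does not depend on the chart.\<close>

lemma openin_interior_points: "openin (mtop M) (points M - mboundary M)"
proof (subst openin_subopen, safe)
  fix p assume p: "p \<in> points M" "p \<notin> mboundary M"
  obtain i where i: "p \<in> cdom M i" using chart_exists p(1) by blast
  define Q where "Q = {q \<in> cdom M i. coord M i q \<in> interior (coord M i ` cdom M i)}"
  have Q: "openin (mtop M) Q"
    unfolding Q_def by (rule openin_coord_preimage) simp
  have "q \<notin> mboundary M" if q: "q \<in> Q" for q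
  proof -
    have "coord M j q \<in> interior (coord M j ` cdom M j)" if j: "q \<in> cdom M j" for j
    proof -
      obtain T where T: "open T" "coord M i ` (cdom M i \<inter> (cdom M j \<inter> Q)) = coord M i ` cdom M i \<inter> T"
        using coord_image_openin[OF openin_Int[OF cdom_openin Q]] by metis
      \<comment> \<open>Invariance of domain needs a set that is open in the model space itself; the
        overlap in chart \<open>i\<close> alone might be only relatively open.\<close>
      define X where "X = interior (coord M i ` cdom M i) \<inter> T"
      have X: "X \<subseteq> coord M i ` (cdom M i \<inter> cdom M j)"
      proof
        fix x assume "x \<in> X"
        then have "x \<in> coord M i ` (cdom M i \<inter> (cdom M j \<inter> Q))"
          using interior_subset[of "coord M i ` cdom M i"] unfolding T(2) X_def by auto
        then show "x \<in> coord M i ` (cdom M i \<inter> cdom M j)" by auto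
      qed
      have "trans_map M i M j ` X \<subseteq> coord M j ` cdom M j"
        using X by (auto simp: trans_map_def cinv_coord subset_iff)
      moreover have "open (trans_map M i M j ` X)"
      proof (rule invariance_of_domain)
        have "smooth_on (coord M i ` (cdom M i \<inter> cdom M j)) (trans_map M i M j)"
          using M by (simp add: smooth_manifold_def smooth_trans_def)
        then show "continuous_on X (trans_map M i M j)"
          using X continuous_on_subset smooth_on_imp_continuous_on by blast
        show "open X" using T(1) by (auto simp: X_def)
        show "inj_on (trans_map M i M j) X"
        proof (rule inj_onI)
          fix x y assume xy: "x \<in> X" "y \<in> X" "trans_map M i M j x = trans_map M i M j y"
          obtain a b where "a \<in> cdom M i \<inter> cdom M j" "b \<in> cdom M i \<inter> cdom M j"
              "x = coord M i a" "y = coord M i b"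
            using X xy(1,2) by blast
          with xy(3) show "x = y"
            using inj_onD[OF coord_inj_on[of j]] by (auto simp: trans_map_def cinv_coord)
        qed
      qed
      moreover have "coord M i q \<in> X"
      proof -
        have "coord M i q \<in> coord M i ` (cdom M i \<inter> (cdom M j \<inter> Q))"
          using q j by (auto simp: Q_def)
        then show ?thesis
          using q unfolding X_def T(2) by (auto simp: Q_def)
      qed
      then have "coord M j q \<in> trans_map M i M j ` X"
        using q by (intro image_eqI[of _ _ "coord M i q"]) (auto simp: trans_map_def Q_def cinv_coord)
      ultimately show ?thesis
        by (meson interiorI)
    qed
    then show ?thesis by (auto simp: mboundary_def)
  qed
  moreover have "p \<in> Q"
    using i p(2) by (auto simp: Q_def mboundary_def)
  moreover have "Q \<subseteq> points M" using Q openin_subset by blast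
  ultimately show "\<exists>T. openin (mtop M) T \<and> p \<in> T \<and> T \<subseteq> points M - mboundary M"
    using Q by blast
qed

lemma continuous_map_smooth_fun:
  assumes "smooth_fun M F"
  shows "continuous_map (mtop M) euclidean F"
proof (rule pasting_lemma[where I=UNIV and T="cdom M" and f="\<lambda>_. F"])
  fix i
  have "continuous_on (coord M i ` cdom M i) (F \<circ> cinv M i)"
    using assms by (intro smooth_on_imp_continuous_on) (simp add: smooth_fun_def)
  then have "continuous_map (subtopology (mtop M) (cdom M i)) euclidean ((F \<circ> cinv M i) \<circ> coord M i)"
    using homeomorphic_imp_continuous_map[OF coord_homeomorphic]
    by (intro continuous_map_compose[of _ "top_of_set (coord M i ` cdom M i)"]) auto
  then show "continuous_map (subtopology (mtop M) (cdom M i)) euclidean F"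
    by (rule continuous_map_eq) (auto simp: cinv_coord)
qed (use cdom_openin chart_exists in auto)

section \<open>Differentials in charts and gluing of smooth functions\<close>

lemma has_derivative_differential:
  assumes "smooth_fun M F" "p \<in> cdom M i"
  shows "((F \<circ> cinv M i) has_derivative differential M F i p)
    (at (coord M i p) within coord M i ` cdom M i)"
  using smooth_on_imp_differentiable[of "coord M i ` cdom M i" "F \<circ> cinv M i" "coord M i p"] assms
  by (simp add: smooth_fun_def differential_def frechet_derivative_works)

text \<open>\<open>differential\<close> is a chosen derivative within the chart image. Uniqueness of
  such derivatives, also at boundary points, identifies it with any derivative that has been
  computed.\<close>

lemma differential_eqI:
  assumes "p \<in> cdom M i"
    and "((F \<circ> cinv M i) has_derivative D) (at (coord M i p) within coord M i ` cdom M i)"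
  shows "differential M F i p = D"
proof -
  have "((F \<circ> cinv M i) has_derivative differential M F i p)
      (at (coord M i p) within coord M i ` cdom M i)"
    using assms(2) unfolding differential_def
    by (metis differentiable_def frechet_derivative_works)
  then show ?thesis
    using has_derivative_unique_chart_image[OF chart_image _ _ assms(2)] assms(1) by blast
qed

text \<open>Translates an identity valid on an open set of \<open>M\<close> into one valid near the
  coordinate point, the form in which derivatives can be transferred.\<close>

lemma eventually_chart_openin:
  assumes "openin (mtop M) Q" "p \<in> cdom M i" "p \<in> Q"
  shows "\<forall>\<^sub>F x in at (coord M i p) within coord M i ` cdom M i. cinv M i x \<in> Q"
proof -
  obtain T where T: "open T" "coord M i ` (cdom M i \<inter> Q) = coord M i ` cdom M i \<inter> T"
    using coord_image_openin[OF assms(1)] by metis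
  have "cinv M i x \<in> Q" if "x \<in> coord M i ` cdom M i" "x \<in> T" for x
  proof -
    have "x \<in> coord M i ` (cdom M i \<inter> Q)" using that T(2) by blast
    then show ?thesis by (auto simp: cinv_coord)
  qed
  moreover have "coord M i p \<in> T" using assms T(2) by blast
  ultimately show ?thesis
    using T(1) by (auto simp: eventually_at_topological)
qed

lemma differential_locally_const:
  assumes "openin (mtop M) Q" "p \<in> cdom M i" "p \<in> Q" "\<And>q. q \<in> Q \<Longrightarrow> F q = c"
  shows "differential M F i p = (\<lambda>v. 0)"
proof (rule differential_eqI[OF assms(2)])
  have "\<forall>\<^sub>F x in at (coord M i p) within coord M i ` cdom M i. c = (F \<circ> cinv M i) x"
    using eventually_chart_openin[OF assms(1-3)] by eventually_elim (simp add: assms(4))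
  then show "((F \<circ> cinv M i) has_derivative (\<lambda>v. 0)) (at (coord M i p) within coord M i ` cdom M i)"
    by (rule has_derivative_transform_eventually[OF has_derivative_const])
      (use assms in \<open>auto simp: cinv_coord\<close>)
qed

lemma differential_compose:
  assumes "openin (mtop M) Q" "p \<in> cdom M i" "p \<in> Q" "\<And>q. q \<in> Q \<Longrightarrow> F q = f (H q)"
    and "smooth_fun M H" "(f has_real_derivative d) (at (H p))"
  shows "differential M F i p = (\<lambda>v. d * differential M H i p v)"
proof (rule differential_eqI[OF assms(2)])
  have "(f has_real_derivative d) (at ((H \<circ> cinv M i) (coord M i p)))"
    using assms(6) by (simp add: cinv_coord[OF assms(2)])
  from DERIV_compose_FDERIV[OF this has_derivative_differential[OF assms(5,2)]]
  have "((\<lambda>x. f ((H \<circ> cinv M i) x)) has_derivative (\<lambda>v. d * differential M H i p v))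
      (at (coord M i p) within coord M i ` cdom M i)"
    by (simp only: mult.commute)
  moreover have "\<forall>\<^sub>F x in at (coord M i p) within coord M i ` cdom M i.
      f ((H \<circ> cinv M i) x) = (F \<circ> cinv M i) x"
    using eventually_chart_openin[OF assms(1-3)] by eventually_elim (simp add: assms(4))
  ultimately show "((F \<circ> cinv M i) has_derivative (\<lambda>v. d * differential M H i p v))
      (at (coord M i p) within coord M i ` cdom M i)"
    by (rule has_derivative_transform_eventually) (use assms in \<open>auto simp: cinv_coord\<close>)
qed

text \<open>Composing \<open>f\<close> with a local smooth extension of \<open>H\<close> gives a
  local smooth extension of \<open>F\<close>. As \<open>H\<close> and \<open>f\<close> may vary with
  the point, this glues a well in \<open>H\<close> to a constant function.\<close>

lemma smooth_funI:
  assumes "\<And>p. p \<in> points M \<Longrightarrow>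
      \<exists>Q. openin (mtop M) Q \<and> p \<in> Q \<and> (\<exists>H f. smooth_fun M H \<and> (\<forall>k. Ck_on k f UNIV) \<and> (\<forall>q\<in>Q. F q = f (H q)))"
  shows "smooth_fun M F"
  unfolding smooth_fun_def smooth_on_def
proof (intro allI ballI)
  fix i x assume x: "x \<in> coord M i ` cdom M i"
  then obtain p where p: "p \<in> cdom M i" "x = coord M i p" by blast
  obtain Q H f where Q: "openin (mtop M) Q" "p \<in> Q" "smooth_fun M H" "\<And>k. Ck_on k f UNIV"
      "\<And>q. q \<in> Q \<Longrightarrow> F q = f (H q)"
    using assms p(1) cdom_subset by (metis subsetD)
  obtain T where T: "open T" "coord M i ` (cdom M i \<inter> Q) = coord M i ` cdom M i \<inter> T"
    using coord_image_openin[OF Q(1)] by metis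
  obtain T' g where g: "open T'" "x \<in> T'" "\<forall>k. Ck_on k g T'"
      "\<forall>y\<in>coord M i ` cdom M i \<inter> T'. g y = (H \<circ> cinv M i) y"
    using Q(3) x unfolding smooth_fun_def smooth_on_def by meson
  have "Ck_on k (\<lambda>y. f (g y)) (T \<inter> T')" for k
  proof (rule Ck_on_compose[OF _ Q(4)])
    show "Ck_on k g (T \<inter> T')"
      using g(3) Ck_on_subset by blast
  qed (use T(1) g(1) in blast)
  moreover have "x \<in> T" using p Q(2) T(2) by blast
  moreover have "f (g y) = (F \<circ> cinv M i) y" if y: "y \<in> coord M i ` cdom M i \<inter> (T \<inter> T')" for y
  proof -
    have "y \<in> coord M i ` (cdom M i \<inter> Q)" using y T(2) by blast
    then have "cinv M i y \<in> Q" by (auto simp: cinv_coord)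
    then show ?thesis using y g(4) Q(5) by auto
  qed
  ultimately show "\<exists>T g. open T \<and> x \<in> T \<and> (\<forall>k. Ck_on k g T) \<and>
      (\<forall>y\<in>coord M i ` cdom M i \<inter> T. g y = (F \<circ> cinv M i) y)"
    using g(1,2) T(1) by (intro exI[of _ "T \<inter> T'"] exI[of _ "\<lambda>y. f (g y)"]) auto
qed

end

section \<open>Restriction to an open subset\<close>

lemma restrict_mfd_simps [simp]:
  "mtop (restrict_mfd M U) = subtopology (mtop M) U"
  "cdom (restrict_mfd M U) i = cdom M i \<inter> U"
  "coord (restrict_mfd M U) = coord M"
  by (auto simp: restrict_mfd_def)

context
  fixes M :: "('a, 'i, 'e::euclidean_space) mfd" and U :: "'a set"
  assumes M: "smooth_manifold M" and U: "openin (mtop M) U"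
begin

lemma points_restrict: "points (restrict_mfd M U) = U"
  using openin_subset[OF U] by auto

lemma cinv_restrict:
  assumes "x \<in> coord M i ` (cdom M i \<inter> U)"
  shows "cinv (restrict_mfd M U) i x = cinv M i x"
proof -
  obtain p where p: "p \<in> cdom M i \<inter> U" "x = coord M i p" using assms by blast
  have "inj_on (coord M i) (cdom M i \<inter> U)"
    by (meson coord_inj_on[OF M] inj_on_subset inf_le1)
  then show ?thesis
    using p by (simp add: cinv_def coord_inj_on[OF M])
qed

lemma smooth_fun_restrict:
  assumes "smooth_fun M F"
  shows "smooth_fun (restrict_mfd M U) F"
  unfolding smooth_fun_def
proof
  fix i
  show "smooth_on (coord (restrict_mfd M U) i ` cdom (restrict_mfd M U) i) (F \<circ> cinv (restrict_mfd M U) i)"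
    by (rule smooth_on_subset[of "coord M i ` cdom M i" "F \<circ> cinv M i"])
      (use assms in \<open>auto simp: smooth_fun_def cinv_restrict\<close>)
qed

lemma smooth_manifold_restrict: "smooth_manifold (restrict_mfd M U)"
  unfolding smooth_manifold_def
proof (intro conjI allI)
  let ?R = "restrict_mfd M U"
  show "Hausdorff_space (mtop ?R)" "second_countable (mtop ?R)"
    using M by (auto simp: smooth_manifold_def Hausdorff_space_subtopology second_countable_subtopology)
  show "(\<Union>i. cdom ?R i) = points ?R"
    using M by (auto simp: smooth_manifold_def)
  fix i
  show "openin (mtop ?R) (cdom ?R i)"
    using cdom_openin[OF M] by (simp add: openin_subtopology_Int)
  obtain T where T: "open T" "coord M i ` (cdom M i \<inter> U) = coord M i ` cdom M i \<inter> T"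
    using coord_image_openin[OF M U] by metis
  show "open (coord ?R i ` cdom ?R i) \<or> openin (top_of_set half_space) (coord ?R i ` cdom ?R i)"
    using chart_image[OF M, of i] T by (auto simp: openin_Int_open)
  have "homeomorphic_map (subtopology (subtopology (mtop M) (cdom M i)) U)
      (subtopology (top_of_set (coord M i ` cdom M i)) (coord M i ` (cdom M i \<inter> U))) (coord M i)"
    by (rule homeomorphic_map_subtopologies[OF coord_homeomorphic[OF M]])
      (auto simp: points_Int_cdom[OF M])
  moreover have "subtopology (top_of_set (coord M i ` cdom M i)) (coord M i ` (cdom M i \<inter> U))
      = top_of_set (coord M i ` (cdom M i \<inter> U))"
    by (simp add: subtopology_subtopology Int_absorb1 image_mono)
  moreover have "subtopology (subtopology (mtop M) (cdom M i)) U = subtopology (subtopology (mtop M) U) (cdom M i \<inter> U)"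
    by (simp add: subtopology_subtopology Int_ac)
  ultimately show "homeomorphic_map (subtopology (mtop ?R) (cdom ?R i)) (top_of_set (coord ?R i ` cdom ?R i)) (coord ?R i)"
    by simp
next
  show "smooth_trans (restrict_mfd M U) (restrict_mfd M U)"
    unfolding smooth_trans_def
  proof (intro allI)
    fix i j
    have "smooth_on (coord M i ` (cdom M i \<inter> cdom M j)) (trans_map M i M j)"
      using M by (simp add: smooth_manifold_def smooth_trans_def)
    then show "smooth_on (coord (restrict_mfd M U) i ` (cdom (restrict_mfd M U) i \<inter> cdom (restrict_mfd M U) j))
        (trans_map (restrict_mfd M U) i (restrict_mfd M U) j)"
      by (rule smooth_on_subset) (auto simp: trans_map_def cinv_restrict)
  qed
qed

text \<open>An interior point of a chart stays interior when the chart is cut down to an open set.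
  Hence sets that avoid the boundary of \<open>M\<close> also avoid that of
  \<open>U\<close>.\<close>

lemma mboundary_restrict: "mboundary (restrict_mfd M U) \<subseteq> mboundary M"
proof
  fix p assume "p \<in> mboundary (restrict_mfd M U)"
  then obtain i where "p \<in> cdom M i" "p \<in> U" "coord M i p \<notin> interior (coord M i ` (cdom M i \<inter> U))"
    by (auto simp: mboundary_def)
  then show "p \<in> mboundary M"
    using coord_interior[OF M U] by blast
qed

lemma differential_restrict:
  assumes "smooth_fun M F" "p \<in> cdom M i" "p \<in> U"
  shows "differential (restrict_mfd M U) F i p = differential M F i p"
proof (rule differential_eqI[OF smooth_manifold_restrict])
  have "((F \<circ> cinv M i) has_derivative differential M F i p)
      (at (coord M i p) within coord M i ` (cdom M i \<inter> U))"
    by (rule has_derivative_subset[OF has_derivative_differential[OF M assms(1,2)]]) blast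
  then have "((F \<circ> cinv (restrict_mfd M U) i) has_derivative differential M F i p)
      (at (coord M i p) within coord M i ` (cdom M i \<inter> U))"
    by (rule has_derivative_transform[rotated 2]) (use assms in \<open>auto simp: cinv_restrict\<close>)
  then show "((F \<circ> cinv (restrict_mfd M U) i) has_derivative differential M F i p)
      (at (coord (restrict_mfd M U) i p) within coord (restrict_mfd M U) i ` cdom (restrict_mfd M U) i)"
    by simp
qed (use assms in auto)

text \<open>The capacity concerns dynamics on \<open>U\<close>, a chord concerns dynamics on
  \<open>M\<close>. The differential of a function smooth on \<open>M\<close> is the same in both,
  hence so is the Hamiltonian vector field along a curve in \<open>U\<close>.\<close>

lemma ham_solution_unrestrict:
  assumes "ham_solution (restrict_mfd M U) \<omega> F J \<gamma>" "smooth_fun M F"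
  shows "ham_solution M \<omega> F J \<gamma>"
proof -
  have U\<gamma>: "\<gamma> t \<in> U" if "t \<in> J" for t
    using assms(1) that by (auto simp: ham_solution_def continuous_map_in_subtopology)
  then have "ham_vf (restrict_mfd M U) \<omega> F i (\<gamma> t) = ham_vf M \<omega> F i (\<gamma> t)"
    if "t \<in> J" "\<gamma> t \<in> cdom M i" for i t
    using that by (simp add: ham_vf_def differential_restrict[OF assms(2)])
  then show ?thesis
    using assms(1) U\<gamma> by (auto simp: ham_solution_def continuous_map_in_subtopology)
qed

end

section \<open>Hamiltonian solutions\<close>

text \<open>Recording the values of \<open>B u\<close> on the basis turns \<open>B\<close> into an
  endomorphism \<open>A\<close> of the model space. It is injective by nondegeneracy, hence
  surjective by finite dimension.\<close>

lemma nondegenerate_bilinear_represents: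
  fixes B :: "'e::euclidean_space \<Rightarrow> 'e \<Rightarrow> real"
  assumes B: "bilinear B" and nd: "\<And>u. (\<And>v. B u v = 0) \<Longrightarrow> u = 0" and L: "linear L"
  shows "\<exists>!X. \<forall>v. B X v = L v"
proof -
  define A where "A u = (\<Sum>b\<in>Basis. B u b *\<^sub>R b)" for u
  have "linear A"
    by (rule linearI) (simp_all add: A_def bilinear_ladd[OF B] bilinear_lmul[OF B]
        scaleR_left_distrib sum.distrib scaleR_sum_right)
  have A0: "A u \<bullet> b = B u b" if "b \<in> Basis" for u b
    using that by (simp add: A_def)
  have ext: "(\<forall>v. B X v = L' v) \<longleftrightarrow> (\<forall>b\<in>Basis. B X b = L' b)" if "linear L'" for X L'
    using B that linear_eq_stdbasis[of "B X" L'] by (auto simp: bilinear_def)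
  have "inj A"
  proof (subst linear_injective_0[OF \<open>linear A\<close>], safe)
    fix u assume "A u = 0"
    then have "\<forall>b\<in>Basis. B u b = 0" using A0[of _ u] by simp
    then have "\<forall>v. B u v = 0" using ext[of "\<lambda>_. 0"] by (simp add: linear_zero)
    then show "u = 0" using nd by blast
  qed
  then have "surj A"
    using \<open>linear A\<close> linear_injective_imp_surjective by blast
  then obtain X where "A X = (\<Sum>b\<in>Basis. L b *\<^sub>R b)" by (metis surjD)
  then have "B X b = L b" if "b \<in> Basis" for b
    using that A0[of b X] by simp
  then have X: "\<forall>v. B X v = L v" using ext[OF L] by blast
  moreover have "Y = X" if "\<forall>v. B Y v = L v" for Y
    using that X nd[of "Y - X"] by (simp add: bilinear_lsub[OF B])
  ultimately show ?thesis by blast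
qed

lemma ham_solution_open_preimage:
  assumes "ham_solution M \<omega> F UNIV \<gamma>" "openin (mtop M) Q"
  shows "open {t. \<gamma> t \<in> Q}"
  using openin_continuous_map_preimage[of euclidean "mtop M" \<gamma> Q] assms
  by (simp add: ham_solution_def)

lemma ham_solution_in_points: "ham_solution M \<omega> F J \<gamma> \<Longrightarrow> t \<in> J \<Longrightarrow> \<gamma> t \<in> points M"
  by (auto simp: ham_solution_def continuous_map_def)

text \<open>In a chart the velocity vanishes, so the curve is locally constant, and the real line is
  connected. Used contrapositively, it finds a time at which a moving solution has nonzero
  velocity.\<close>

lemma ham_solution_constant:
  assumes M: "smooth_manifold M" and \<gamma>: "ham_solution M \<omega> F UNIV \<gamma>"
    and zero: "\<And>t i. \<gamma> t \<in> cdom M i \<Longrightarrow> ham_vf M \<omega> F i (\<gamma> t) = 0"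
  shows "\<gamma> s = \<gamma> t"
proof (rule connected_local_const[of UNIV])
  show "\<forall>t\<in>UNIV. \<forall>\<^sub>F s in at t within UNIV. \<gamma> t = \<gamma> s"
  proof
    fix t
    obtain i where i: "\<gamma> t \<in> cdom M i"
      using chart_exists[OF M] ham_solution_in_points[OF \<gamma>] by blast
    have "open {s. \<gamma> s \<in> cdom M i}"
      using ham_solution_open_preimage[OF \<gamma> cdom_openin[OF M]] .
    then obtain e where e: "0 < e" "ball t e \<subseteq> {s. \<gamma> s \<in> cdom M i}"
      using i openE by blast
    have "\<gamma> t = \<gamma> s" if s: "s \<in> ball t e" for s
    proof -
      have "((\<lambda>s. coord M i (\<gamma> s)) has_derivative (\<lambda>h. 0)) (at r)" if "r \<in> ball t e" for r
      proof -
        have "\<gamma> r \<in> cdom M i" using that e by blast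
        then have "((\<lambda>s. coord M i (\<gamma> s)) has_vector_derivative 0) (at r)"
          using \<gamma> zero unfolding ham_solution_def by fastforce
        then show ?thesis by (simp add: has_vector_derivative_def)
      qed
      then have "coord M i (\<gamma> t) = coord M i (\<gamma> s)"
        by (rule has_derivative_zero_unique_connected[of "ball t e", rotated 2]) (use e s in auto)
      then show ?thesis
        using inj_onD[OF coord_inj_on[OF M]] e s i by blast
    qed
    then show "\<forall>\<^sub>F s in at t within UNIV. \<gamma> t = \<gamma> s"
      using e(1) by (auto simp: eventually_at intro!: exI[of _ e] simp: dist_commute)
  qed
qed auto

text \<open>The chain rule contributes 1/d, which cancels the factor \<open>d\<close>. Negative
  \<open>d\<close> is allowed and reverses the orbit; the offset \<open>a\<close> then selects the
  starting point.\<close>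

lemma ham_solution_reparametrize:
  assumes \<gamma>: "ham_solution M \<omega> F UNIV \<gamma>" and "d \<noteq> 0"
    and vf: "\<And>t i. \<gamma> t \<in> cdom M i \<Longrightarrow> ham_vf M \<omega> F i (\<gamma> t) = d *\<^sub>R ham_vf M \<omega> H i (\<gamma> t)"
  shows "ham_solution M \<omega> H J (\<lambda>s. \<gamma> (a + s / d))"
  unfolding ham_solution_def
proof (intro conjI ballI allI impI)
  have "continuous_map euclidean (mtop M) \<gamma>"
    using \<gamma> by (simp add: ham_solution_def)
  moreover have "continuous_map (top_of_set J) euclidean (\<lambda>s. a + s / d)"
    using \<open>d \<noteq> 0\<close> by (auto intro!: continuous_intros)
  ultimately show "continuous_map (top_of_set J) (mtop M) (\<lambda>s. \<gamma> (a + s / d))"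
    using continuous_map_compose[of "top_of_set J" euclidean "\<lambda>s. a + s / d" "mtop M" \<gamma>]
    by (simp add: o_def)
  fix s i assume s: "s \<in> J" and i: "\<gamma> (a + s / d) \<in> cdom M i"
  have "((\<lambda>r. coord M i (\<gamma> r)) has_vector_derivative ham_vf M \<omega> F i (\<gamma> (a + s / d))) (at (a + s / d))"
    using \<gamma> i by (auto simp: ham_solution_def)
  moreover have "((\<lambda>s. a + s / d) has_vector_derivative 1 / d) (at s within J)"
    using \<open>d \<noteq> 0\<close> by (auto intro!: derivative_eq_intros simp: has_real_derivative_iff_has_vector_derivative[symmetric])
  ultimately have "((\<lambda>r. coord M i (\<gamma> r)) \<circ> (\<lambda>s. a + s / d) has_vector_derivative
      (1 / d) *\<^sub>R ham_vf M \<omega> F i (\<gamma> (a + s / d))) (at s within J)"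
    by (intro vector_diff_chain_within) (auto intro: has_vector_derivative_at_within)
  then show "((\<lambda>s. coord M i (\<gamma> (a + s / d))) has_vector_derivative ham_vf M \<omega> H i (\<gamma> (a + s / d))) (at s within J)"
    using vf[OF i] \<open>d \<noteq> 0\<close> by (simp add: o_def)
qed

section \<open>Hamiltonian vector fields and conservation of energy\<close>

context
  fixes M :: "('a, 'i, 'e::euclidean_space) mfd" and \<omega> :: "('a, 'i, 'e) form2"
  assumes M: "smooth_manifold M"
    and bil: "\<And>i p. p \<in> cdom M i \<Longrightarrow> bilinear (\<omega> i p)"
    and alt: "\<And>i p v. p \<in> cdom M i \<Longrightarrow> \<omega> i p v v = 0"
    and nondeg: "nondegenerate_2form M \<omega>"
begin

lemma ham_vf_ex1:
  assumes "smooth_fun M F" "p \<in> cdom M i"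
  shows "\<exists>!X. \<forall>v. \<omega> i p X v = - differential M F i p v"
proof (rule nondegenerate_bilinear_represents[OF bil[OF assms(2)]])
  show "u = 0" if "\<And>v. \<omega> i p u v = 0" for u
    using nondeg assms(2) that by (auto simp: nondegenerate_2form_def)
  show "linear (\<lambda>v. - differential M F i p v)"
    using has_derivative_linear[OF has_derivative_differential[OF M assms]]
    by (rule linear_compose_neg)
qed

lemma ham_vf_works:
  assumes "smooth_fun M F" "p \<in> cdom M i"
  shows "\<omega> i p (ham_vf M \<omega> F i p) v = - differential M F i p v"
  using theI'[OF ham_vf_ex1[OF assms]] unfolding ham_vf_def by blast

lemma ham_vf_eqI:
  assumes "smooth_fun M F" "p \<in> cdom M i" "\<And>v. \<omega> i p X v = - differential M F i p v"
  shows "ham_vf M \<omega> F i p = X"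
  unfolding ham_vf_def using assms(3) by (intro the1_equality[OF ham_vf_ex1[OF assms(1,2)]]) blast

lemma ham_vf_scale:
  assumes "smooth_fun M F" "smooth_fun M H" "p \<in> cdom M i"
    and "differential M F i p = (\<lambda>v. d * differential M H i p v)"
  shows "ham_vf M \<omega> F i p = d *\<^sub>R ham_vf M \<omega> H i p"
  using assms
  by (intro ham_vf_eqI) (simp_all add: bilinear_lmul[OF bil] ham_vf_works)

text \<open>The derivative of \<open>H\<close> along the curve is dH(d X_H) = -d \<omega>(X_H, X_H)
  = 0. Away from the boundary the differential is a full derivative of \<open>H\<close> in the
  chart, so the ordinary chain rule applies.\<close>

lemma energy_derivative_zero:
  assumes \<gamma>: "ham_solution M \<omega> F UNIV \<gamma>" and H: "smooth_fun M H"
    and i: "\<gamma> t \<in> cdom M i" and nb: "\<gamma> t \<notin> mboundary M"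
    and vf: "ham_vf M \<omega> F i (\<gamma> t) = d *\<^sub>R ham_vf M \<omega> H i (\<gamma> t)"
  shows "((\<lambda>s. H (\<gamma> s)) has_derivative (\<lambda>h. 0)) (at t)"
proof -
  let ?c = "\<lambda>s. coord M i (\<gamma> s)"
  have c: "(?c has_derivative (\<lambda>h. h *\<^sub>R ham_vf M \<omega> F i (\<gamma> t))) (at t)"
    using \<gamma> i by (auto simp: ham_solution_def has_vector_derivative_def)
  have "coord M i (\<gamma> t) \<in> interior (coord M i ` cdom M i)"
    using nb i by (auto simp: mboundary_def)
  then have D: "((H \<circ> cinv M i) has_derivative differential M H i (\<gamma> t)) (at (?c t))"
    using has_derivative_differential[OF M H i] by (simp only: at_within_interior)
  have "differential M H i (\<gamma> t) (h *\<^sub>R ham_vf M \<omega> F i (\<gamma> t)) = 0" for h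
    using ham_vf_works[OF H i, of "(h * d) *\<^sub>R ham_vf M \<omega> H i (\<gamma> t)"] alt[OF i]
    by (simp add: vf bilinear_rmul[OF bil[OF i]])
  with has_derivative_compose[OF c D]
  have "((\<lambda>s. (H \<circ> cinv M i) (?c s)) has_derivative (\<lambda>h. 0)) (at t)"
    by simp
  then show ?thesis
  proof (rule has_derivative_transform_within_open)
    show "open {s. \<gamma> s \<in> cdom M i}"
      using ham_solution_open_preimage[OF \<gamma> cdom_openin[OF M]] .
  qed (use i in \<open>auto simp: cinv_coord[OF M]\<close>)
qed

text \<open>A constant solution would force X_H, and with it dH, to vanish at the starting point.
  This is needed for chords because a moving solution may be known to move only at a time outside
  the interval of the chord.\<close>

lemma ham_solution_nonconstant:
  assumes \<gamma>: "ham_solution M \<omega> H {0..T} \<gamma>" and "0 < T" and H: "smooth_fun M H"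
    and i: "\<gamma> 0 \<in> cdom M i" and v: "differential M H i (\<gamma> 0) v \<noteq> 0"
  shows "\<exists>t\<in>{0..T}. \<gamma> t \<noteq> \<gamma> 0"
proof (rule ccontr)
  assume "\<not> ?thesis"
  then have const: "\<And>t. t \<in> {0..T} \<Longrightarrow> coord M i (\<gamma> 0) = coord M i (\<gamma> t)" by metis
  have "((\<lambda>t. coord M i (\<gamma> 0)) has_vector_derivative 0) (at 0 within {0..T})"
    by (rule has_vector_derivative_const)
  then have "((\<lambda>t. coord M i (\<gamma> t)) has_vector_derivative 0) (at 0 within {0..T})"
    by (rule has_vector_derivative_transform[rotated 2]) (use const \<open>0 < T\<close> in auto)
  moreover have "((\<lambda>t. coord M i (\<gamma> t)) has_vector_derivative ham_vf M \<omega> H i (\<gamma> 0)) (at 0 within {0..T})"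
    using \<gamma> i \<open>0 < T\<close> by (auto simp: ham_solution_def)
  ultimately have "ham_vf M \<omega> H i (\<gamma> 0) = 0"
    using vector_derivative_unique_within_closed_interval[of 0 T 0] \<open>0 < T\<close> by force
  then have "\<omega> i (\<gamma> 0) 0 v = - differential M H i (\<gamma> 0) v"
    using ham_vf_works[OF H i, of v] by simp
  then show False
    using v bilinear_lzero[OF bil[OF i]] by simp
qed

text \<open>A solution that moves somewhere lies in the region where \<open>F = f \<circ> H\<close> is not locally constant.
  There it moves along a level of \<open>H\<close>, on which the factor \<open>f' \<circ> H\<close> is a nonzero constant, so it never
  leaves this region.\<close>

lemma ham_solution_stays_on_level:
  assumes F: "smooth_fun M F" and H: "smooth_fun M H"
    and V: "openin (mtop M) V" "V \<inter> mboundary M = {}"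
    and W: "closedin (mtop M) W" "W \<subseteq> V"
    and FV: "\<And>x. x \<in> V \<Longrightarrow> F x = f (H x)" and FW: "\<And>x. x \<in> points M - W \<Longrightarrow> F x = m"
    and f: "\<And>s. (f has_real_derivative f' s) (at s)"
    and f'0: "\<And>x. x \<in> V - W \<Longrightarrow> f' (H x) = 0"
    and \<gamma>: "ham_solution M \<omega> F UNIV \<gamma>" and move: "\<gamma> t1 \<noteq> \<gamma> 0"
  obtains c where "f' c \<noteq> 0" "\<And>t. \<gamma> t \<in> W" "\<And>t. H (\<gamma> t) = c"
    "\<And>t i. \<gamma> t \<in> cdom M i \<Longrightarrow> ham_vf M \<omega> F i (\<gamma> t) = f' c *\<^sub>R ham_vf M \<omega> H i (\<gamma> t)"
proof -
  have vf: "ham_vf M \<omega> F i p = f' (H p) *\<^sub>R ham_vf M \<omega> H i p" if "p \<in> V" "p \<in> cdom M i" for p i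
    by (rule ham_vf_scale[OF F H that(2)])
      (rule differential_compose[OF M V(1) that(2,1) FV H f])
  obtain t0 i0 where t0: "\<gamma> t0 \<in> cdom M i0" "ham_vf M \<omega> F i0 (\<gamma> t0) \<noteq> 0"
    using ham_solution_constant[OF M \<gamma>] move by blast
  have t0W: "\<gamma> t0 \<in> W"
  proof (rule ccontr)
    assume "\<gamma> t0 \<notin> W"
    then have p: "\<gamma> t0 \<in> points M - W" using ham_solution_in_points[OF \<gamma>] by blast
    have "openin (mtop M) (points M - W)" using W(1) by blast
    then have "differential M F i0 (\<gamma> t0) = (\<lambda>v. 0)"
      by (rule differential_locally_const[OF M _ t0(1) p FW])
    then have "ham_vf M \<omega> F i0 (\<gamma> t0) = 0"
      by (intro ham_vf_eqI[OF F t0(1)]) (simp add: bilinear_lzero[OF bil[OF t0(1)]])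
    with t0(2) show False by blast
  qed
  define c where "c = H (\<gamma> t0)"
  have f'c: "f' c \<noteq> 0"
    using vf[of "\<gamma> t0" i0] t0 t0W W(2) by (auto simp: c_def)
  \<comment> \<open>A clopen argument along the real line: both \<open>P\<close> and its negation
    are open conditions on the time.\<close>
  define P where "P t \<longleftrightarrow> \<gamma> t \<in> W \<and> H (\<gamma> t) = c" for t
  have "P t = P t0" for t
  proof (rule connected_local_const[of UNIV t t0 P])
    show "\<forall>t\<in>UNIV. \<forall>\<^sub>F s in at t within UNIV. P t = P s"
    proof
      fix t
      have Hc: "continuous_map (mtop M) euclidean H"
        by (rule continuous_map_smooth_fun[OF M H])
      show "\<forall>\<^sub>F s in at t within UNIV. P t = P s"
      proof (cases "P t")
        case True
        have "open {s. \<gamma> s \<in> V}" by (rule ham_solution_open_preimage[OF \<gamma> V(1)])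
        moreover have "t \<in> {s. \<gamma> s \<in> V}" using True W(2) by (auto simp: P_def)
        ultimately obtain e where e: "0 < e" "ball t e \<subseteq> {s. \<gamma> s \<in> V}"
          using openE by blast
        have "P s" if s: "s \<in> ball t e" for s
        proof -
          have "((\<lambda>s. H (\<gamma> s)) has_derivative (\<lambda>h. 0)) (at r)" if "r \<in> ball t e" for r
          proof -
            have r: "\<gamma> r \<in> V" using that e(2) by blast
            then obtain i where i: "\<gamma> r \<in> cdom M i"
              using chart_exists[OF M] ham_solution_in_points[OF \<gamma>] by blast
            show ?thesis
              by (rule energy_derivative_zero[OF \<gamma> H i _ vf[OF r i]]) (use r V(2) in blast)
          qed
          then have "H (\<gamma> s) = H (\<gamma> t)"
            by (rule has_derivative_zero_unique_connected[of "ball t e", rotated 2]) (use e s in auto)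
          then have "H (\<gamma> s) = c" using True by (simp add: P_def)
          moreover have "\<gamma> s \<in> V" using s e(2) by blast
          \<comment> \<open>Leaving \<open>W\<close> inside \<open>V\<close> would make
            \<open>f'\<close> vanish at the level \<open>c\<close>, contrary to \<open>f'c\<close>;
            so the conserved energy keeps the curve in \<open>W\<close>.\<close>
          ultimately show ?thesis using f'0[of "\<gamma> s"] f'c by (auto simp: P_def)
        qed
        with True e(1) show ?thesis
          by (auto simp: eventually_at intro!: exI[of _ e] simp: dist_commute)
      next
        case False
        have "openin (mtop M) {x \<in> points M. H x \<in> - {c}}"
          using openin_continuous_map_preimage[OF Hc, of "- {c}"] by (simp add: open_Compl)
        moreover have "openin (mtop M) (points M - W)" using W(1) by blast
        ultimately have "openin (mtop M) ((points M - W) \<union> {x \<in> points M. H x \<in> - {c}})"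
          by blast
        from ham_solution_open_preimage[OF \<gamma> this]
        have "open {s. \<gamma> s \<in> (points M - W) \<union> {x \<in> points M. H x \<in> - {c}}}" .
        also have "{s. \<gamma> s \<in> (points M - W) \<union> {x \<in> points M. H x \<in> - {c}}} = {s. \<not> P s}"
          using ham_solution_in_points[OF \<gamma>] by (auto simp: P_def)
        finally have "open {s. \<not> P s}" .
        then have "\<forall>\<^sub>F s in at t. s \<in> {s. \<not> P s}"
          using False by (intro eventually_at_in_open') auto
        then show ?thesis
          by eventually_elim (use False in auto)
      qed
    qed
  qed auto
  then have P: "P t" for t
    using t0W by (auto simp: P_def c_def)
  then have "\<gamma> t \<in> V" "H (\<gamma> t) = c" for t
    using W(2) by (auto simp: P_def)
  with vf have "ham_vf M \<omega> F i (\<gamma> t) = f' c *\<^sub>R ham_vf M \<omega> H i (\<gamma> t)" if "\<gamma> t \<in> cdom M i" for t i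
    using that by metis
  with f'c P show thesis
    using that by (auto simp: P_def)
qed

end

section \<open>Neighbourhoods of a compact regular level\<close>

text \<open>The points of \<open>G\<close> are interior, so closed coordinate balls are compact
  neighbourhoods of them inside \<open>G\<close>; finitely many of the open balls cover
  \<open>S\<close>.\<close>

lemma compact_neighbourhood_exists:
  fixes M :: "('a, 'i, 'e::euclidean_space) mfd"
  assumes M: "smooth_manifold M" and G: "openin (mtop M) G" "G \<inter> mboundary M = {}"
    and S: "compactin (mtop M) S" "S \<subseteq> G"
  obtains V C where "openin (mtop M) V" "compactin (mtop M) C" "S \<subseteq> V" "V \<subseteq> C" "C \<subseteq> G"
proof -
  define \<U> where "\<U> = {B. openin (mtop M) B \<and> (\<exists>C. compactin (mtop M) C \<and> B \<subseteq> C \<and> C \<subseteq> G)}"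
  have "p \<in> \<Union>\<U>" if p: "p \<in> S" for p
  proof -
    have pG: "p \<in> G" using p S(2) by blast
    obtain i where i: "p \<in> cdom M i"
      using chart_exists[OF M] pG openin_subset[OF G(1)] by blast
    have "coord M i p \<in> interior (coord M i ` (cdom M i \<inter> G))"
      using coord_interior[OF M G(1) i pG] pG G(2) by blast
    then obtain r where r: "0 < r" "cball (coord M i p) r \<subseteq> coord M i ` (cdom M i \<inter> G)"
      by (meson mem_interior_cball)
    define B where "B = {q \<in> cdom M i. coord M i q \<in> ball (coord M i p) r}"
    define C where "C = cinv M i ` cball (coord M i p) r"
    have "openin (mtop M) B"
      unfolding B_def by (rule openin_coord_preimage[OF M open_ball])
    moreover have "compactin (mtop M) C"
      unfolding C_def
      by (rule image_compactin[OF _ continuous_map_cinv[OF M]])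
        (use r(2) in \<open>auto simp: compactin_subtopology\<close>)
    moreover have "B \<subseteq> C"
    proof
      fix q assume "q \<in> B"
      then have "q = cinv M i (coord M i q)" "coord M i q \<in> cball (coord M i p) r"
        by (auto simp: B_def cinv_coord[OF M])
      then show "q \<in> C" unfolding C_def by blast
    qed
    moreover have "C \<subseteq> G"
      unfolding C_def
    proof (rule image_subsetI)
      fix x assume "x \<in> cball (coord M i p) r"
      then obtain q where "q \<in> cdom M i \<inter> G" "x = coord M i q" using r(2) by blast
      then show "cinv M i x \<in> G" by (simp add: cinv_coord[OF M])
    qed
    ultimately have "B \<in> \<U>" by (auto simp: \<U>_def)
    moreover have "p \<in> B" using i r(1) by (simp add: B_def)
    ultimately show ?thesis by blast
  qed
  then have "S \<subseteq> \<Union>\<U>" by blast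
  moreover have "\<And>B. B \<in> \<U> \<Longrightarrow> openin (mtop M) B" by (simp add: \<U>_def)
  ultimately obtain \<F> where \<F>: "finite \<F>" "\<F> \<subseteq> \<U>" "S \<subseteq> \<Union>\<F>"
    using compactinD[OF S(1)] by metis
  have "\<forall>B\<in>\<F>. \<exists>C. compactin (mtop M) C \<and> B \<subseteq> C \<and> C \<subseteq> G"
    using \<F>(2) by (auto simp: \<U>_def)
  then obtain c where c: "\<And>B. B \<in> \<F> \<Longrightarrow> compactin (mtop M) (c B) \<and> B \<subseteq> c B \<and> c B \<subseteq> G"
    by metis
  show thesis
  proof (rule that)
    show "openin (mtop M) (\<Union>\<F>)" using \<F>(2) by (auto simp: \<U>_def)
    show "compactin (mtop M) (\<Union>(c ` \<F>))" using c \<F>(1) by (intro compactin_Union) auto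
    show "S \<subseteq> \<Union>\<F>" by (rule \<F>(3))
    show "\<Union>\<F> \<subseteq> \<Union>(c ` \<F>)" "\<Union>(c ` \<F>) \<subseteq> G" using c by blast+
  qed
qed

text \<open>Near \<open>p\<close> the differential is the derivative of one smooth extension
  \<open>g\<close>, whose value on the fixed vector \<open>v\<close> depends continuously on the
  point and so stays nonzero.\<close>

lemma openin_regular_points:
  fixes M :: "('a, 'i, 'e::euclidean_space) mfd"
  assumes M: "smooth_manifold M" and H: "smooth_fun M H"
  shows "openin (mtop M) {p. \<exists>i v. p \<in> cdom M i \<and> differential M H i p v \<noteq> 0}"
proof (subst openin_subopen, safe)
  fix p i v assume p: "p \<in> cdom M i" and v: "differential M H i p v \<noteq> 0"
  have "smooth_on (coord M i ` cdom M i) (H \<circ> cinv M i)" "coord M i p \<in> coord M i ` cdom M i"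
    using H p by (auto simp: smooth_fun_def)
  then obtain T g where T: "open T" "coord M i p \<in> T" and g: "\<forall>k. Ck_on k g T"
      and gH: "\<forall>y\<in>coord M i ` cdom M i \<inter> T. g y = (H \<circ> cinv M i) y"
    unfolding smooth_on_def by meson
  have g1: "Ck_on 1 g T" using g by blast
  have D: "differential M H i q = frechet_derivative g (at (coord M i q))"
    if q: "q \<in> cdom M i" "coord M i q \<in> T" for q
  proof (rule differential_eqI[OF M q(1)])
    have "(g has_derivative frechet_derivative g (at (coord M i q))) (at (coord M i q))"
      using g1 q(2) by (simp add: frechet_derivative_works)
    then have "(g has_derivative frechet_derivative g (at (coord M i q)))
        (at (coord M i q) within coord M i ` cdom M i)"
      by (rule has_derivative_at_withinI)
    moreover have "\<forall>\<^sub>F x in at (coord M i q) within coord M i ` cdom M i. g x = (H \<circ> cinv M i) x"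
      using T(1) q(2) gH by (auto simp: eventually_at_topological)
    ultimately show "((H \<circ> cinv M i) has_derivative frechet_derivative g (at (coord M i q)))
        (at (coord M i q) within coord M i ` cdom M i)"
      by (rule has_derivative_transform_eventually) (use q gH in auto)
  qed
  define T' where "T' = T \<inter> (\<lambda>x. frechet_derivative g (at x) v) -` (- {0})"
  have "open T'"
    unfolding T'_def using g1 T(1) by (intro continuous_open_preimage) auto
  then have "openin (mtop M) {q \<in> cdom M i. coord M i q \<in> T'}"
    by (rule openin_coord_preimage[OF M])
  moreover have "p \<in> {q \<in> cdom M i. coord M i q \<in> T'}"
    using p T(2) v D[OF p] by (auto simp: T'_def)
  moreover have "{q \<in> cdom M i. coord M i q \<in> T'} \<subseteq> {p. \<exists>i v. p \<in> cdom M i \<and> differential M H i p v \<noteq> 0}"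
    using D by (fastforce simp: T'_def)
  ultimately show "\<exists>T. openin (mtop M) T \<and> p \<in> T \<and>
      T \<subseteq> {p. \<exists>i v. p \<in> cdom M i \<and> differential M H i p v \<noteq> 0}"
    by blast
qed

text \<open>The values of \<open>H\<close> on the compact set \<open>C - V\<close> form a closed set
  missing \<open>c\<close>. The restriction to \<open>C\<close> is essential, as nearby levels may
  have further parts elsewhere.\<close>

lemma level_gap_exists:
  assumes X: "Hausdorff_space X" and H: "continuous_map X euclidean H"
    and V: "openin X V" and C: "compactin X C" and S: "{x \<in> C. H x = c} \<subseteq> V"
  obtains \<rho> :: real where "0 < \<rho>" "\<And>x. x \<in> C \<Longrightarrow> \<bar>H x - c\<bar> \<le> \<rho> \<Longrightarrow> x \<in> V"
proof -
  have "closedin X (C - V)"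
    using compactin_imp_closedin[OF X C] V by (simp add: closedin_diff)
  then have "compactin X (C - V)"
    by (rule closed_compactin[OF C Diff_subset])
  then have "compact (H ` (C - V))"
    using image_compactin[OF _ H] by simp
  then have "open (- (H ` (C - V)))"
    by (simp add: compact_imp_closed open_Compl)
  moreover have "c \<in> - (H ` (C - V))" using S by auto
  ultimately obtain e where e: "0 < e" "cball c e \<subseteq> - (H ` (C - V))"
    using open_contains_cball by blast
  show thesis
  proof (rule that[OF e(1)])
    fix x assume "x \<in> C" "\<bar>H x - c\<bar> \<le> e"
    then show "x \<in> V" using e(2) by (auto simp: dist_real_def abs_minus_commute subset_iff)
  qed
qed

text \<open>A nonzero derivative at the single point 0 gives values on both sides of
  \<open>\<phi> 0\<close>; the intermediate value theorem fills the gap.\<close>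

lemma image_contains_interval:
  fixes \<phi> :: "real \<Rightarrow> real"
  assumes cont: "continuous_on {-r..r} \<phi>" and D: "(\<phi> has_real_derivative d) (at 0)"
    and "d \<noteq> 0" "0 < r"
  obtains \<delta> where "0 < \<delta>" "{\<phi> 0 - \<delta>..\<phi> 0 + \<delta>} \<subseteq> \<phi> ` {-r..r}"
proof -
  have "\<exists>x\<in>{-r..r}. \<exists>y\<in>{-r..r}. \<psi> x < \<psi> 0 \<and> \<psi> 0 < \<psi> y"
    if D: "(\<psi> has_real_derivative d) (at 0)" and "0 < d" for \<psi> d
  proof -
    obtain e1 where e1: "0 < e1" "\<And>h. 0 < h \<Longrightarrow> h < e1 \<Longrightarrow> \<psi> 0 < \<psi> (0 + h)"
      using DERIV_pos_inc_right[OF D \<open>0 < d\<close>] by blast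
    obtain e2 where e2: "0 < e2" "\<And>h. 0 < h \<Longrightarrow> h < e2 \<Longrightarrow> \<psi> (0 - h) < \<psi> 0"
      using DERIV_pos_inc_left[OF D \<open>0 < d\<close>] by blast
    define h where "h = min r (min e1 e2) / 2"
    have h: "0 < h" "h < e1" "h < e2" "h \<le> r"
      using e1(1) e2(1) \<open>0 < r\<close> by (auto simp: h_def)
    with e1(2)[of h] e2(2)[of h] show ?thesis
      by (intro bexI[of _ "- h"] bexI[of _ h]) auto
  qed
  from this[OF D] this[OF DERIV_minus[OF D]] \<open>d \<noteq> 0\<close>
  obtain x y where xy: "x \<in> {-r..r}" "y \<in> {-r..r}" "\<phi> x < \<phi> 0" "\<phi> 0 < \<phi> y"
    by (cases "0 < d") fastforce+
  have "connected (\<phi> ` {-r..r})"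
    by (intro connected_continuous_image cont) simp
  then have I: "{\<phi> x..\<phi> y} \<subseteq> \<phi> ` {-r..r}"
    using xy(1,2) by (intro connected_contains_Icc) auto
  show thesis
  proof (rule that[of "min (\<phi> 0 - \<phi> x) (\<phi> y - \<phi> 0)"])
    have "{\<phi> 0 - min (\<phi> 0 - \<phi> x) (\<phi> y - \<phi> 0)..\<phi> 0 + min (\<phi> 0 - \<phi> x) (\<phi> y - \<phi> 0)} \<subseteq> {\<phi> x..\<phi> y}"
      by auto
    then show "{\<phi> 0 - min (\<phi> 0 - \<phi> x) (\<phi> y - \<phi> 0)..\<phi> 0 + min (\<phi> 0 - \<phi> x) (\<phi> y - \<phi> 0)} \<subseteq> \<phi> ` {-r..r}"
      using I by blast
  qed (use xy in auto)
qed

text \<open>Transversality makes the restriction of \<open>H\<close> to \<open>N\<close> a submersion near \<open>p\<close>, so \<open>N\<close> meets all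
  nearby levels near \<open>p\<close>.\<close>

lemma submanifold_meets_nearby_levels:
  fixes M :: "('a, 'i, 'e::euclidean_space) mfd" and N :: "('a, 'j, 'f::euclidean_space) mfd"
  assumes M: "smooth_manifold M" and H: "smooth_fun M H"
    and N: "properly_embedded N M" and tr: "transverse_to_level M N H c"
    and p: "p \<in> points N" "p \<notin> mboundary M" "H p = c"
    and reg: "\<And>i. p \<in> cdom M i \<Longrightarrow> \<exists>v. differential M H i p v \<noteq> 0"
    and V: "openin (mtop M) V" "p \<in> V"
  obtains \<delta> where "0 < \<delta>" "{c - \<delta>..c + \<delta>} \<subseteq> H ` (points N \<inter> V)"
proof -
  \<comment> \<open>Proper embedding enters through
    \<open>mboundary N \<subseteq> mboundary M\<close>: it makes \<open>p\<close> interior in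
    \<open>N\<close>, so \<open>N\<close> contains a two-sided curve through
    \<open>p\<close>.\<close>
  have N': "smooth_manifold N" and id: "continuous_map (mtop N) (mtop M) (\<lambda>p. p)"
    and sm: "smooth_trans N M" and pN: "p \<notin> mboundary N"
    using N p(2) by (auto simp: properly_embedded_def embedded_submanifold_def immersed_submanifold_def)
  obtain i where i: "p \<in> cdom M i"
    using chart_exists[OF M] V openin_subset by blast
  let ?dH = "differential M H i p"
  have dH: "linear ?dH"
    using has_derivative_linear[OF has_derivative_differential[OF M H i]] .
  obtain v where v: "?dH v \<noteq> 0" using reg[OF i] by blast
  \<comment> \<open>Splitting a vector \<open>v\<close> with nonzero dH leaves a tangent vector
    \<open>u\<close> of \<open>N\<close> with nonzero dH, since dH kills the other summand.\<close>
  have "v \<in> {u + w | u w. u \<in> tangent_space M N i p \<and> ?dH w = 0}"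
    using tr p i unfolding transverse_to_level_def by blast
  then obtain u w where uw: "v = u + w" "u \<in> tangent_space M N i p" "?dH w = 0" by blast
  then obtain j a where j: "p \<in> cdom N j" and a: "u = jac N j M i p a"
    by (auto simp: tangent_space_def)
  have dHa: "?dH (jac N j M i p a) \<noteq> 0"
    using v uw(1,3) a linear_add[OF dH] by simp
  define Q where "Q = cdom M i \<inter> V"
  define x0 where "x0 = coord N j p"
  let ?\<tau> = "trans_map N j M i"
  have "openin (mtop M) Q" unfolding Q_def using cdom_openin[OF M] V(1) by blast
  then have "openin (mtop N) {x \<in> points N. x \<in> Q}"
    using openin_continuous_map_preimage[OF id] by simp
  then have x0: "x0 \<in> interior (coord N j ` (cdom N j \<inter> {x \<in> points N. x \<in> Q}))" (is "_ \<in> interior ?E")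
    unfolding x0_def using coord_interior[OF N' _ j _ pN] p(1) i V(2) by (auto simp: Q_def)
  have E: "?E \<subseteq> coord N j ` (cdom N j \<inter> cdom M i)"
    by (auto simp: Q_def)
  have "smooth_on (coord N j ` (cdom N j \<inter> cdom M i)) ?\<tau>"
    using sm by (simp add: smooth_trans_def)
  then have "?\<tau> differentiable (at x0 within coord N j ` (cdom N j \<inter> cdom M i))"
    by (rule smooth_on_imp_differentiable) (use i j in \<open>auto simp: x0_def\<close>)
  then have "(?\<tau> has_derivative jac N j M i p) (at x0 within coord N j ` (cdom N j \<inter> cdom M i))"
    unfolding jac_def x0_def by (simp only: frechet_derivative_works)
  moreover have "at x0 within coord N j ` (cdom N j \<inter> cdom M i) = at x0"
    using x0 interior_mono[OF E] by (intro at_within_interior) blast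
  ultimately have \<tau>: "(?\<tau> has_derivative jac N j M i p) (at x0)" by simp
  have \<tau>x0: "?\<tau> x0 = coord M i p"
    by (simp add: trans_map_def x0_def cinv_coord[OF N' j])
  have "coord M i p \<in> interior (coord M i ` cdom M i)"
    using p(2) i by (auto simp: mboundary_def)
  then have "((H \<circ> cinv M i) has_derivative ?dH) (at (?\<tau> x0))"
    unfolding \<tau>x0 using has_derivative_differential[OF M H i] by (simp only: at_within_interior)
  from has_derivative_compose[OF \<tau> this]
  have "((\<lambda>x. (H \<circ> cinv M i) (?\<tau> x)) has_derivative (\<lambda>b. ?dH (jac N j M i p b))) (at x0)" .
  then have HN: "((H \<circ> cinv N j) has_derivative (\<lambda>b. ?dH (jac N j M i p b))) (at x0)"
  proof (rule has_derivative_transform_within_open[OF _ open_interior x0])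
    fix x assume "x \<in> interior ?E"
    then have "x \<in> ?E" using interior_subset by blast
    then show "(H \<circ> cinv M i) (?\<tau> x) = (H \<circ> cinv N j) x"
      by (auto simp: trans_map_def Q_def cinv_coord[OF N'] cinv_coord[OF M])
  qed
  \<comment> \<open>\<open>H\<close> along the coordinate line of \<open>N\<close> with velocity
    \<open>a\<close>; its derivative at 0 is dH(u), which is nonzero.\<close>
  define \<phi> where "\<phi> t = (H \<circ> cinv N j) (x0 + t *\<^sub>R a)" for t
  have "open ((\<lambda>t. x0 + t *\<^sub>R a) -` interior ?E)"
    by (intro open_vimage continuous_intros) simp
  moreover have "0 \<in> (\<lambda>t. x0 + t *\<^sub>R a) -` interior ?E"
    using x0 by simp
  ultimately obtain r where r: "0 < r" "cball 0 r \<subseteq> (\<lambda>t. x0 + t *\<^sub>R a) -` interior ?E"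
    using open_contains_cball by blast
  have rE: "x0 + t *\<^sub>R a \<in> ?E" if "t \<in> {-r..r}" for t
  proof -
    have "t \<in> cball 0 r" using that by auto
    then show ?thesis using r(2) interior_subset by blast
  qed
  have "continuous_map (top_of_set (coord N j ` cdom N j)) euclidean (H \<circ> (\<lambda>p. p) \<circ> cinv N j)"
    by (intro continuous_map_compose[OF continuous_map_cinv[OF N']]
        continuous_map_compose[OF id] continuous_map_smooth_fun[OF M H])
  then have "continuous_on (coord N j ` cdom N j) (H \<circ> cinv N j)"
    by (simp add: o_def)
  then have "continuous_on {-r..r} \<phi>"
    unfolding \<phi>_def
  proof (rule continuous_on_compose2)
    show "(\<lambda>t. x0 + t *\<^sub>R a) ` {-r..r} \<subseteq> coord N j ` cdom N j"
      using rE by blast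
  qed (intro continuous_intros)
  moreover have "(\<phi> has_real_derivative ?dH (jac N j M i p a)) (at 0)"
  proof -
    have lin: "linear (\<lambda>b. ?dH (jac N j M i p b))"
      using has_derivative_linear[OF HN] .
    have "((\<lambda>t. x0 + t *\<^sub>R a) has_derivative (\<lambda>t. t *\<^sub>R a)) (at 0)"
      by (auto intro!: derivative_eq_intros)
    moreover have "((H \<circ> cinv N j) has_derivative (\<lambda>b. ?dH (jac N j M i p b))) (at (x0 + 0 *\<^sub>R a))"
      using HN by simp
    ultimately have "(\<phi> has_derivative (\<lambda>t. ?dH (jac N j M i p (t *\<^sub>R a)))) (at 0)"
      unfolding \<phi>_def by (rule has_derivative_compose)
    then show ?thesis
      by (rule has_derivative_imp_has_field_derivative) (use linear_scale[OF lin] in simp)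
  qed
  ultimately obtain \<delta> where \<delta>: "0 < \<delta>" "{\<phi> 0 - \<delta>..\<phi> 0 + \<delta>} \<subseteq> \<phi> ` {-r..r}"
    using image_contains_interval dHa r(1) by metis
  have "\<phi> 0 = c" using p(3) by (simp add: \<phi>_def x0_def cinv_coord[OF N' j])
  moreover have "\<phi> ` {-r..r} \<subseteq> H ` (points N \<inter> V)"
  proof (rule image_subsetI)
    fix t assume "t \<in> {-r..r}"
    from rE[OF this] show "\<phi> t \<in> H ` (points N \<inter> V)"
      by (auto simp: \<phi>_def Q_def cinv_coord[OF N'])
  qed
  ultimately show thesis using that \<delta> by blast
qed

section \<open>Leafwise chords\<close>

text \<open>By the definition of the capacity as a supremum, \<open>F\<close> is not admissible. An
  empty set of return times would make the infimum infinite, so some return exists; its time is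
  immaterial after a later reparametrization.\<close>

lemma capacity_less_imp_moving_solution:
  assumes cap: "capacity_in M U N \<omega> R < ennreal m"
    and simple: "simple_ham (restrict_mfd M U) (N \<inter> U) F m"
  obtains \<gamma> t1 T where "ham_solution (restrict_mfd M U) \<omega> F UNIV \<gamma>" "\<gamma> t1 \<noteq> \<gamma> 0"
    "0 < T" "R (\<gamma> 0) (\<gamma> T)"
proof -
  let ?R = "restrict_rel R (N \<inter> U)"
  have "\<not> admissible (restrict_mfd M U) \<omega> (N \<inter> U) ?R F"
  proof
    assume "admissible (restrict_mfd M U) \<omega> (N \<inter> U) ?R F"
    with simple have "ennreal m \<le> capacity_in M U N \<omega> R"
      unfolding capacity_in_def coisotropic_capacity_def by (intro Sup_upper) blast
    with cap show False by simp
  qed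
  then obtain \<gamma> where \<gamma>: "ham_solution (restrict_mfd M U) \<omega> F UNIV \<gamma>" "\<not> (\<forall>t. \<gamma> t = \<gamma> 0)"
      "\<not> return_time (N \<inter> U) ?R \<gamma> > 1"
    unfolding admissible_def by blast
  have "{t. 0 < t \<and> \<gamma> t \<in> N \<inter> U \<and> ?R (\<gamma> 0) (\<gamma> t)} \<noteq> {}"
  proof
    assume "{t. 0 < t \<and> \<gamma> t \<in> N \<inter> U \<and> ?R (\<gamma> 0) (\<gamma> t)} = {}"
    then have "return_time (N \<inter> U) ?R \<gamma> = \<infinity>"
      unfolding return_time_def by (simp only: image_empty Inf_empty top_ereal_def)
    with \<gamma>(3) show False by simp
  qed
  then show thesis using that \<gamma>(1,2) by (auto simp: restrict_rel_def)
qed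

lemma leafwise_chord_of_scaled_solution:
  fixes M :: "('a, 'i, 'e::euclidean_space) mfd" and N :: "('a, 'j, 'f::euclidean_space) mfd"
  assumes sym: "symplectic_manifold M \<omega>" and H: "smooth_fun M H" and U: "openin (mtop M) U"
    and \<gamma>: "ham_solution (restrict_mfd M U) \<omega> F UNIV \<gamma>" and "d \<noteq> 0"
    and vf: "\<And>t i. \<gamma> t \<in> cdom (restrict_mfd M U) i \<Longrightarrow>
        ham_vf (restrict_mfd M U) \<omega> F i (\<gamma> t) = d *\<^sub>R ham_vf (restrict_mfd M U) \<omega> H i (\<gamma> t)"
    and c: "\<And>t. H (\<gamma> t) = c"
    and reg: "\<And>t. \<exists>i v. \<gamma> t \<in> cdom M i \<and> differential M H i (\<gamma> t) v \<noteq> 0"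
    and T: "0 < T" "leaf_rel TYPE('g::euclidean_space) M \<omega> N (\<gamma> 0) (\<gamma> T)"
  shows "\<exists>T \<gamma>. leafwise_chord TYPE('g) M \<omega> N H c T \<gamma>"
proof -
  have M: "smooth_manifold M" and nd: "nondegenerate_2form M \<omega>"
    and bil: "\<And>i p. p \<in> cdom M i \<Longrightarrow> bilinear (\<omega> i p)"
    and alt: "\<And>i p v. p \<in> cdom M i \<Longrightarrow> \<omega> i p v v = 0"
    using sym by (auto simp: symplectic_manifold_def smooth_2form_def)
  \<comment> \<open>For \<open>d < 0\<close> the direction is reversed and the chord runs from \<open>\<gamma> T\<close> to \<open>\<gamma> 0\<close>.\<close>
  define a where "a = (if 0 < d then 0 else T)"
  define \<delta> where "\<delta> s = \<gamma> (a + s / d)" for s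
  define T' where "T' = \<bar>d\<bar> * T"
  have T': "0 < T'" using T(1) \<open>d \<noteq> 0\<close> by (simp add: T'_def)
  have "ham_solution (restrict_mfd M U) \<omega> H {0..T'} \<delta>"
    unfolding \<delta>_def by (rule ham_solution_reparametrize[OF \<gamma> \<open>d \<noteq> 0\<close> vf])
  then have \<delta>: "ham_solution M \<omega> H {0..T'} \<delta>"
    by (rule ham_solution_unrestrict[OF M U _ H])
  obtain i v where "\<delta> 0 \<in> cdom M i" "differential M H i (\<delta> 0) v \<noteq> 0"
    using reg unfolding \<delta>_def by blast
  from ham_solution_nonconstant[OF M bil alt nd \<delta> T' H this]
  have "\<exists>t\<in>{0..T'}. \<delta> t \<noteq> \<delta> 0" .
  moreover have "leaf_rel TYPE('g) M \<omega> N (\<delta> 0) (\<delta> T')"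
  proof (cases "0 < d")
    case True
    then show ?thesis using T(2) by (simp add: \<delta>_def a_def T'_def)
  next
    case False
    then have "\<delta> 0 = \<gamma> T" "\<delta> T' = \<gamma> 0"
      using \<open>d \<noteq> 0\<close> by (auto simp: \<delta>_def a_def T'_def)
    then show ?thesis using T(2) by (auto simp: leaf_rel_def)
  qed
  ultimately show ?thesis
    using \<delta> T' c unfolding leafwise_chord_def
    by (intro exI[of _ T'] exI[of _ \<delta>]) (auto simp: \<delta>_def)
qed

text \<open>The well argument for one target level \<open>\<mu>\<close>. The inequality relating
  \<open>\<mu>\<close>, \<open>\<epsilon>\<close> and \<open>\<rho>\<close> keeps the whole well
  inside the window where both \<open>gap\<close> and \<open>lev\<close> are available.\<close>

lemma chord_near_level:
  fixes M :: "('a, 'i, 'e::euclidean_space) mfd" and N :: "('a, 'j, 'f::euclidean_space) mfd"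
  assumes sym: "symplectic_manifold M \<omega>" and H: "smooth_fun M H"
    and U: "openin (mtop M) U" and V: "openin (mtop M) V" and C: "compactin (mtop M) C"
    and VCU: "V \<subseteq> C" "C \<subseteq> U" "C \<inter> mboundary M = {}"
    and reg: "\<And>x. x \<in> C \<Longrightarrow> \<exists>i v. x \<in> cdom M i \<and> differential M H i x v \<noteq> 0"
    and gap: "\<And>x. x \<in> C \<Longrightarrow> \<bar>H x - 1\<bar> \<le> \<rho> \<Longrightarrow> x \<in> V"
    and lev: "{1 - \<rho>..1 + \<rho>} \<subseteq> H ` (points N \<inter> V)"
    and cap: "capacity_in M U (points N) \<omega> (leaf_rel TYPE('g::euclidean_space) M \<omega> N) < \<infinity>"
    and \<epsilon>: "0 < \<epsilon>" "\<bar>\<mu> - 1\<bar> + \<epsilon> \<le> \<rho>"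
  shows "\<exists>c. \<bar>c - \<mu>\<bar> < \<epsilon> \<and> (\<exists>T \<gamma>. leafwise_chord TYPE('g) M \<omega> N H c T \<gamma>)"
proof -
  let ?A = "restrict_mfd M U"
  have M: "smooth_manifold M" and nd: "nondegenerate_2form M \<omega>"
    and bil: "\<And>i p. p \<in> cdom M i \<Longrightarrow> bilinear (\<omega> i p)"
    and alt: "\<And>i p v. p \<in> cdom M i \<Longrightarrow> \<omega> i p v v = 0"
    using sym by (auto simp: symplectic_manifold_def smooth_2form_def)
  have A: "smooth_manifold ?A" by (rule smooth_manifold_restrict[OF M U])
  have ndA: "nondegenerate_2form ?A \<omega>" using nd by (auto simp: nondegenerate_2form_def)
  have HA: "smooth_fun ?A H" by (rule smooth_fun_restrict[OF M U H])
  have Hc: "continuous_map (mtop M) euclidean H" by (rule continuous_map_smooth_fun[OF M H])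
  have haus: "Hausdorff_space (mtop M)" using M by (simp add: smooth_manifold_def)
  have pU: "points ?A = U" by (rule points_restrict[OF M U])
  have slab: "compactin (mtop M) {x \<in> C. \<bar>H x - s\<bar> \<le> b}" for s b
  proof (rule closed_compactin[OF C])
    have "closed {y. \<bar>y - s\<bar> \<le> b}"
      by (intro closed_Collect_le continuous_intros)
    then have "closedin (mtop M) {x \<in> points M. H x \<in> {y. \<bar>y - s\<bar> \<le> b}}"
      using closedin_continuous_map_preimage[OF Hc, of "{y. \<bar>y - s\<bar> \<le> b}"] by simp
    then have "closedin (mtop M) (C \<inter> {x \<in> points M. H x \<in> {y. \<bar>y - s\<bar> \<le> b}})"
      using compactin_imp_closedin[OF haus C] by blast
    also have "C \<inter> {x \<in> points M. H x \<in> {y. \<bar>y - s\<bar> \<le> b}} = {x \<in> C. \<bar>H x - s\<bar> \<le> b}"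
      using compactin_subset_topspace[OF C] by auto
    finally show "closedin (mtop M) {x \<in> C. \<bar>H x - s\<bar> \<le> b}" .
  qed auto
  \<comment> \<open>Finiteness of the capacity is used here: a real number above it exists.\<close>
  obtain m where m: "0 < m" "capacity_in M U (points N) \<omega> (leaf_rel TYPE('g) M \<omega> N) < ennreal m"
  proof -
    obtain r where r: "0 \<le> r" "capacity_in M U (points N) \<omega> (leaf_rel TYPE('g) M \<omega> N) = ennreal r"
      using cap by (cases "capacity_in M U (points N) \<omega> (leaf_rel TYPE('g) M \<omega> N)") auto
    show thesis
      by (rule that[of "r + 1"]) (use r in \<open>auto simp: ennreal_less_iff\<close>)
  qed
  \<comment> \<open>Any constants with 0 < a < b < \<open>\<epsilon>\<close> would do. The strict
    bound by \<open>\<epsilon>\<close> leaves the level \<open>\<mu> + \<epsilon>\<close> outside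
    the well.\<close>
  define b where "b = \<epsilon> / 2"
  define a where "a = \<epsilon> / 4"
  have ab: "0 < a" "a < b" "b < \<epsilon>" using \<epsilon> by (auto simp: a_def b_def)
  obtain f where f: "\<And>k. Ck_on k f UNIV" "\<And>s. b \<le> \<bar>s - \<mu>\<bar> \<Longrightarrow> f s = m"
      "\<And>s. \<bar>s - \<mu>\<bar> \<le> a \<Longrightarrow> f s = 0" "\<And>s. 0 \<le> f s" "\<And>s. f s \<le> m"
    using smooth_well_exists[OF ab(1,2) m(1), of \<mu>] by metis
  have Df: "(f has_real_derivative deriv f s) (at s)" for s
    using f(1)[of 1] by (simp add: DERIV_deriv_iff_real_differentiable)
  have f'0: "deriv f s = 0" if "b < \<bar>s - \<mu>\<bar>" for s
  proof -
    have "open {s. b < \<bar>s - \<mu>\<bar>}" by (intro open_Collect_less continuous_intros)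
    then have "(f has_real_derivative 0) (at s)"
      using that f(2)
      by (intro has_field_derivative_transform_within_open[OF DERIV_const[of m]]) auto
    then show ?thesis by (rule DERIV_imp_deriv)
  qed
  \<comment> \<open>Membership in \<open>C\<close> is part of \<open>W\<close>, so that other parts
    of the same levels inside \<open>U\<close>, if any, receive the value \<open>m\<close>.\<close>
  define W where "W = {x \<in> C. \<bar>H x - 1\<bar> \<le> \<rho>}"
  define F where "F x = (if x \<in> W then f (H x) else m)" for x
  have WV: "W \<subseteq> V" using gap by (auto simp: W_def)
  have far: "b < \<bar>H x - \<mu>\<bar>" if "x \<in> C - W" for x
    using that \<epsilon> ab by (auto simp: W_def)
  \<comment> \<open>Between \<open>W\<close> and the edge of \<open>V\<close> the two formulas for
    \<open>F\<close> agree: by \<open>far\<close> the well has already reached \<open>m\<close>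
    there. This overlap makes the gluing smooth.\<close>
  have FV: "F x = f (H x)" if "x \<in> V" for x
    using f(2) far[of x] that VCU(1) by (force simp: F_def)
  have VA: "openin (mtop ?A) V" "V \<inter> mboundary ?A = {}"
    using V VCU mboundary_restrict[OF M U] by (auto simp: openin_subtopology)
  have WA: "closedin (mtop ?A) W"
    using compactin_imp_closedin[OF haus slab[of 1 \<rho>]] WV VCU
    by (auto simp: W_def closedin_subtopology)
  have FA: "smooth_fun ?A F"
  proof (rule smooth_funI[OF A])
    fix p assume "p \<in> points ?A"
    show "\<exists>Q. openin (mtop ?A) Q \<and> p \<in> Q \<and>
        (\<exists>H f. smooth_fun ?A H \<and> (\<forall>k. Ck_on k f UNIV) \<and> (\<forall>q\<in>Q. F q = f (H q)))"
    proof (cases "p \<in> V")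
      case True
      with VA(1) FV HA f(1) show ?thesis by blast
    next
      case False
      then have "p \<in> points ?A - W" using \<open>p \<in> points ?A\<close> WV by blast
      moreover have "openin (mtop ?A) (points ?A - W)" using WA by blast
      moreover have "\<forall>q\<in>points ?A - W. F q = (\<lambda>_. m) (H q)" by (simp add: F_def)
      ultimately show ?thesis
        by (intro exI[of _ "points ?A - W"] exI[of _ H] exI[of _ "\<lambda>_. m"] conjI allI HA Ck_on_const)
    qed
  qed
  \<comment> \<open>Two points of \<open>N\<close>: one at the bottom of the well shows that
    \<open>K\<close> and \<open>Q\<close> meet \<open>N\<close>, the other beyond its rim shows that
    they do not contain \<open>N \<inter> U\<close>.\<close>
  have q1: "\<mu> \<in> {1 - \<rho>..1 + \<rho>}" and q2: "\<mu> + \<epsilon> \<in> {1 - \<rho>..1 + \<rho>}" using \<epsilon> by auto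
  obtain q where q: "q \<in> points N" "q \<in> V" "H q = \<mu>" using subsetD[OF lev q1] unfolding image_iff by (metis IntE)
  obtain q' where q': "q' \<in> points N" "q' \<in> V" "H q' = \<mu> + \<epsilon>" using subsetD[OF lev q2] unfolding image_iff by (metis IntE)
  have "simple_ham ?A (points N \<inter> U) F m"
    unfolding simple_ham_def pU
  proof (intro conjI)
    show "smooth_fun ?A F" by (rule FA)
    show "\<exists>K. compactin (mtop ?A) K \<and> K \<subseteq> U - mboundary ?A \<and> K \<inter> (points N \<inter> U) \<noteq> {} \<and>
        K \<inter> (points N \<inter> U) \<subset> points N \<inter> U \<and> (\<forall>x\<in>U - K. F x = m)"
    proof (intro exI[of _ "{x \<in> C. \<bar>H x - \<mu>\<bar> \<le> b}"] conjI)
      let ?K = "{x \<in> C. \<bar>H x - \<mu>\<bar> \<le> b}"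
      show "compactin (mtop ?A) ?K" using slab VCU(2) by (auto simp: compactin_subtopology)
      show "?K \<subseteq> U - mboundary ?A" using VCU mboundary_restrict[OF M U] by auto
      have "q \<in> ?K \<inter> (points N \<inter> U)" using q VCU ab by auto
      then show "?K \<inter> (points N \<inter> U) \<noteq> {}" by blast
      have "q' \<in> points N \<inter> U - ?K" using q' VCU ab by auto
      then show "?K \<inter> (points N \<inter> U) \<subset> points N \<inter> U" by blast
      show "\<forall>x\<in>U - ?K. F x = m"
      proof
        fix x assume "x \<in> U - ?K"
        then have "x \<in> W \<Longrightarrow> f (H x) = m" by (intro f(2)) (auto simp: W_def)
        then show "F x = m" by (simp add: F_def)
      qed
    qed
    show "\<exists>Q. openin (mtop ?A) Q \<and> Q \<inter> (points N \<inter> U) \<noteq> {} \<and>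
        Q \<inter> (points N \<inter> U) \<subset> points N \<inter> U \<and> (\<forall>x\<in>Q. F x = 0)"
    proof (intro exI[of _ "{x \<in> V. \<bar>H x - \<mu>\<bar> < a}"] conjI)
      let ?Q = "{x \<in> V. \<bar>H x - \<mu>\<bar> < a}"
      have "open {y. \<bar>y - \<mu>\<bar> < a}" by (intro open_Collect_less continuous_intros)
      then have "openin (mtop M) {x \<in> points M. H x \<in> {y. \<bar>y - \<mu>\<bar> < a}}"
        using openin_continuous_map_preimage[OF Hc, of "{y. \<bar>y - \<mu>\<bar> < a}"] by simp
      then have "openin (mtop M) (V \<inter> {x \<in> points M. H x \<in> {y. \<bar>y - \<mu>\<bar> < a}})"
        using V by blast
      also have "V \<inter> {x \<in> points M. H x \<in> {y. \<bar>y - \<mu>\<bar> < a}} = ?Q"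
        using openin_subset[OF V] by auto
      finally have "openin (mtop M) ?Q" .
      then show "openin (mtop ?A) ?Q" using VCU by (auto simp: openin_subtopology)
      have "q \<in> ?Q \<inter> (points N \<inter> U)" using q VCU ab by auto
      then show "?Q \<inter> (points N \<inter> U) \<noteq> {}" by blast
      have "q' \<in> points N \<inter> U - ?Q" using q' VCU ab by auto
      then show "?Q \<inter> (points N \<inter> U) \<subset> points N \<inter> U" by blast
      show "\<forall>x\<in>?Q. F x = 0" using f(3) FV by auto
    qed
    show "\<forall>x\<in>U. 0 \<le> F x \<and> F x \<le> m" using f(4,5) m(1) by (simp add: F_def)
  qed
  then obtain \<gamma> t1 T where \<gamma>: "ham_solution ?A \<omega> F UNIV \<gamma>" "\<gamma> t1 \<noteq> \<gamma> 0"
      and T: "0 < T" "leaf_rel TYPE('g) M \<omega> N (\<gamma> 0) (\<gamma> T)"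
    using capacity_less_imp_moving_solution[OF m(2)] by metis
  obtain c where c: "deriv f c \<noteq> 0" "\<And>t. \<gamma> t \<in> W" "\<And>t. H (\<gamma> t) = c"
      "\<And>t i. \<gamma> t \<in> cdom ?A i \<Longrightarrow> ham_vf ?A \<omega> F i (\<gamma> t) = deriv f c *\<^sub>R ham_vf ?A \<omega> H i (\<gamma> t)"
  proof (rule ham_solution_stays_on_level[OF A _ _ ndA FA HA VA WA WV FV _ Df _ \<gamma>])
    show "F x = m" if "x \<in> points ?A - W" for x using that by (simp add: F_def)
    show "deriv f (H x) = 0" if "x \<in> V - W" for x
      using that VCU(1) by (intro f'0 far) blast
  qed (use bil alt in auto)
  have "\<exists>i v. \<gamma> t \<in> cdom M i \<and> differential M H i (\<gamma> t) v \<noteq> 0" for t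
    using c(2)[of t] by (intro reg) (simp add: W_def)
  from leafwise_chord_of_scaled_solution[OF sym H U \<gamma>(1) c(1,4,3) this T]
  have "\<exists>T \<gamma>. leafwise_chord TYPE('g) M \<omega> N H c T \<gamma>" .
  \<comment> \<open>A nonzero slope of \<open>f\<close> at \<open>c\<close> excludes distance
    greater than \<open>b\<close> from \<open>\<mu>\<close>.\<close>
  moreover have "\<bar>c - \<mu>\<bar> < \<epsilon>" using f'0[of c] c(1) ab(3) by linarith
  ultimately show ?thesis by blast
qed

theorem theorem4p2:
  fixes M :: "('a, 'i, 'e::euclidean_space) mfd"
    and N :: "('a, 'j, 'f::euclidean_space) mfd"
    and \<omega> :: "('a, 'i, 'e) form2"
    and H :: "'a \<Rightarrow> real"
    and S U :: "'a set"
    and n k :: nat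
  assumes "symplectic_manifold M \<omega>"
    and "DIM('e) = 2 * n"
    and "smooth_fun M H"
    and "S = {x \<in> points M. H x = 1}"
    and "compactin (mtop M) S"
    and "\<And>x i. x \<in> S \<Longrightarrow> x \<in> cdom M i \<Longrightarrow> \<exists>v. differential M H i x v \<noteq> 0"
    and "S \<inter> mboundary M = {}"
    and "properly_embedded N M"
    and "k < n"
    and "DIM('f) = n + k"
    and "coisotropic M \<omega> N"
    and "DIM('g::euclidean_space) = n - k"
    and "transverse_to_level M N H 1"
    and "points N \<inter> S \<noteq> {}"
    and "openin (mtop M) U"
    and "S \<subseteq> U"
    and "capacity_in M U (points N) \<omega> (leaf_rel TYPE('g) M \<omega> N) < \<infinity>"
  shows "\<exists>\<rho>>0. \<exists>\<Sigma>. \<Sigma> \<subseteq> {1 - \<rho>..1 + \<rho>} \<and> {1 - \<rho>..1 + \<rho>} \<subseteq> closure \<Sigma> \<and>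
           (\<forall>c\<in>\<Sigma>. \<exists>T \<gamma>. leafwise_chord TYPE('g) M \<omega> N H c T \<gamma>)"
proof -
  note H = assms(3) and reg = assms(6)
  have M: "smooth_manifold M" using assms(1) by (simp add: symplectic_manifold_def)
  \<comment> \<open>All local requirements on the neighbourhood of \<open>S\<close> at once; each of
    the three conditions is open and holds on \<open>S\<close>.\<close>
  define G where "G = U \<inter> (points M - mboundary M) \<inter> {p. \<exists>i v. p \<in> cdom M i \<and> differential M H i p v \<noteq> 0}"
  have G: "openin (mtop M) G" "G \<inter> mboundary M = {}"
    unfolding G_def
    using assms(15) openin_interior_points[OF M] openin_regular_points[OF M H] by blast+
  have "S \<subseteq> G"
    using assms(4,7,16) reg chart_exists[OF M] unfolding G_def by blast
  then obtain V C where V: "openin (mtop M) V" and C: "compactin (mtop M) C"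
      and VC: "S \<subseteq> V" "V \<subseteq> C" "C \<subseteq> G"
    using compact_neighbourhood_exists[OF M G assms(5)] by metis
  have "{x \<in> C. H x = 1} \<subseteq> V"
    using VC(1) assms(4) compactin_subset_topspace[OF C] by auto
  moreover have "Hausdorff_space (mtop M)" using M by (simp add: smooth_manifold_def)
  ultimately obtain \<rho>\<^sub>1 where \<rho>\<^sub>1: "0 < \<rho>\<^sub>1" "\<And>x. x \<in> C \<Longrightarrow> \<bar>H x - 1\<bar> \<le> \<rho>\<^sub>1 \<Longrightarrow> x \<in> V"
    using level_gap_exists[OF _ continuous_map_smooth_fun[OF M H] V C] by metis
  obtain p where p: "p \<in> points N" "p \<in> S" using assms(14) by blast
  then have "p \<notin> mboundary M" "H p = 1" "p \<in> V"
    using assms(4,7) VC(1) by auto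
  then obtain \<rho>\<^sub>2 where \<rho>\<^sub>2: "0 < \<rho>\<^sub>2" "{1 - \<rho>\<^sub>2..1 + \<rho>\<^sub>2} \<subseteq> H ` (points N \<inter> V)"
    using submanifold_meets_nearby_levels[OF M H assms(8,13) p(1) _ _ reg[OF p(2)] V] by metis
  \<comment> \<open>The first bound confines nearby levels within \<open>C\<close> to
    \<open>V\<close>; the second ensures that \<open>N\<close> meets all of them in
    \<open>V\<close>.\<close>
  define \<rho> where "\<rho> = min \<rho>\<^sub>1 \<rho>\<^sub>2"
  have near: "\<exists>c. \<bar>c - \<mu>\<bar> < \<epsilon> \<and> (\<exists>T \<gamma>. leafwise_chord TYPE('g) M \<omega> N H c T \<gamma>)"
    if "0 < \<epsilon>" "\<bar>\<mu> - 1\<bar> + \<epsilon> \<le> \<rho>" for \<mu> \<epsilon>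
  proof (rule chord_near_level[OF assms(1) H assms(15) V C VC(2) _ _ _ _ _ assms(17) that])
    show "C \<subseteq> U" "C \<inter> mboundary M = {}" using VC(3) by (auto simp: G_def)
    show "\<exists>i v. x \<in> cdom M i \<and> differential M H i x v \<noteq> 0" if "x \<in> C" for x
      using that VC(3) by (auto simp: G_def)
    show "x \<in> V" if "x \<in> C" "\<bar>H x - 1\<bar> \<le> \<rho>" for x
      using that \<rho>\<^sub>1(2) by (simp add: \<rho>_def)
    have "{1 - \<rho>..1 + \<rho>} \<subseteq> {1 - \<rho>\<^sub>2..1 + \<rho>\<^sub>2}" by (simp add: \<rho>_def)
    then show "{1 - \<rho>..1 + \<rho>} \<subseteq> H ` (points N \<inter> V)" using \<rho>\<^sub>2(2) by blast
  qed
  define \<Sigma> where "\<Sigma> = {c \<in> {1 - \<rho>..1 + \<rho>}. \<exists>T \<gamma>. leafwise_chord TYPE('g) M \<omega> N H c T \<gamma>}"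
  have \<rho>: "0 < \<rho>" using \<rho>\<^sub>1(1) \<rho>\<^sub>2(1) by (simp add: \<rho>_def)
  have "{1 - \<rho><..<1 + \<rho>} \<subseteq> closure \<Sigma>"
  proof
    fix \<mu> assume \<mu>: "\<mu> \<in> {1 - \<rho><..<1 + \<rho>}"
    show "\<mu> \<in> closure \<Sigma>"
      unfolding closure_approachable
    proof (intro allI impI)
      fix e :: real assume "0 < e"
      \<comment> \<open>The second entry keeps the well, and therefore the level \<open>c\<close>
        that is found, inside the window.\<close>
      define \<epsilon> where "\<epsilon> = min e (\<rho> - \<bar>\<mu> - 1\<bar>)"
      have \<epsilon>: "0 < \<epsilon>" "\<epsilon> \<le> e" "\<bar>\<mu> - 1\<bar> + \<epsilon> \<le> \<rho>"
        using \<mu> \<open>0 < e\<close> by (auto simp: \<epsilon>_def)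
      then obtain c where "\<bar>c - \<mu>\<bar> < \<epsilon>" "\<exists>T \<gamma>. leafwise_chord TYPE('g) M \<omega> N H c T \<gamma>"
        using near by blast
      with \<epsilon> show "\<exists>c\<in>\<Sigma>. dist c \<mu> < e"
        by (intro bexI[of _ c]) (auto simp: \<Sigma>_def dist_real_def)
    qed
  qed
  \<comment> \<open>At the two ends of the window there is no room for a well, so they are reached
    only as limits of interior levels.\<close>
  then have "closure {1 - \<rho><..<1 + \<rho>} \<subseteq> closure \<Sigma>"
    by (intro closure_minimal) auto
  then have "{1 - \<rho>..1 + \<rho>} \<subseteq> closure \<Sigma>"
    using \<rho> by simp
  with \<rho> show ?thesis
    by (intro exI[of _ \<rho>] conjI exI[of _ \<Sigma>]) (auto simp: \<Sigma>_def)
qed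

end
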